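(* There is a constant $\kappa_0>0$ such that for every $\kappa\in(0,\kappa_0]$, $K>0$ and $\alpha>0$ the following holds. Let $h=1/M$, $N=M^n$, $\Delta t=\kappa h$, let $(d_h^k,w_h^k)_{k\ge0}$ be a solution of the angular momentum scheme with $|d^0_{\underline i}|\le1$ for all $\underline i$ and discrete energy $E_0\le K$, let $m\ge0$, and take the tolerance $\epsilon=N^{-\alpha}$. Then, given $(d_h^m,w_h^m)$, there is a number of iterations $\bar s\ge 1$ for which the iterates of the fixed point iteration satisfy the stopping criterion $$\left\|w_h^{m,\bar s+1}-w_h^{m,\bar s}\right\|_{L^2(\Omega)}+\left\|\nabla_h d_h^{m,\bar s+1}-\nabla_h d_h^{m,\bar s}\right\|_{L^2(\Omega)}<\epsilon$$ and the error bound $$\left\|w_h^{m+1}-w_h^{m,s}\right\|_{L^2(\Omega)}+\left\|\nabla_h d_h^{m+1}-\nabla_h d_h^{m,s}\right\|_{L^2(\Omega)}<\epsilon\quad\text{for all }s\ge\bar s,$$ and such that the functions $(d_h^{m,\bar s},w_h^{m,\bar s})$ may be computed using only $O(N\log N)$ operations as $N\to\infty$ (with the implied constant depending only on $n$, $\kappa$, $K$, $\alpha$).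
   Context: Domain and grid: $\Omega=\mathbb{T}^n$ or $\Omega=[0,1]^n$ (homogeneous Neumann), $n\in\{2,3\}$, $h=1/M$, $M\ge2$ an integer. Grid functions are indexed by $\underline i\in\mathcal I=\{0,\dots,M\}^n$ in the box case and by indices modulo $M$ in the torus case; in the box case they are extended to ghost indices $-1,M+1$ in each coordinate by $f_{-1}=f_0$, $f_{M+1}=f_M$. With $e_j$ the $j$-th unit multiindex, $D_j^+f_{\underline i}=(f_{\underline i+e_j}-f_{\underline i})/h$, $D_j^-f_{\underline i}=D_j^+f_{\underline i-e_j}$, $\nabla_h=(D_1^-,\dots,D_n^-)^T$, $\Delta_h=\sum_{j=1}^nD_j^+D_j^-$. A grid function $f$ is identified with the function $f_h$ that is constant, equal to $f_{\underline i}$, on the cell of side $h$ centred at $h\underline i$; $\int_\Omega f_h\,dx$ means $h^n\sum_{\underline i}f_{\underline i}$ and $\|f_h\|_{L^2(\Omega)}^2=h^n\sum_{\underline i}|f_{\underline i}|^2$. Scheme: $d^m_{\underline i},w^m_{\underline i}\in\mathbb{R}^3$, $m\geq 0$, satisfy, with $f^{m+1/2}=\tfrac12(f^m+f^{m+1})$, $$\frac{d^{m+1}_{\underline i}-d^m_{\underline i}}{\Delta t}=d^{m+1/2}_{\underline i}\times w^{m+1/2}_{\underline i},\qquad \frac{w^{m+1}_{\underline i}-w^m_{\underline i}}{\Delta t}=\Delta_hd^{m+1/2}_{\underline i}\times d^{m+1/2}_{\underline i}.$$ The discrete energy is $E_m=\tfrac12\int_\Omega|\nabla_hd_h^m|^2+|w_h^m|^2\,dx$.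 Fixed point iteration: $(d_h^{m,0},w_h^{m,0})=(d_h^m,w_h^m)$, and for $s\ge0$, $(d_h^{m,s+1},w_h^{m,s+1})$ solves $$\frac{d_h^{m,s+1}-d_h^m}{\Delta t}=\tfrac12\big(d_h^m+d_h^{m,s+1}\big)\times\tfrac12\big(w_h^m+w_h^{m,s}\big),$$ $$\frac{w_h^{m,s+1}-w_h^m}{\Delta t}=\tfrac12\big(\Delta_hd_h^m+\Delta_hd_h^{m,s+1}\big)\times\tfrac12\big(d_h^m+d_h^{m,s+1}\big).$$ (The first equation is linear and uniquely solvable for $d_h^{m,s+1}$, pointwise in $\underline i$; the second is then explicit.) "Operations" are real arithmetic operations ($+,-,\times,/$) on grid values, starting from the grid values of $(d_h^m,w_h^m)$. *)

theory Defs
  imports "HOL-Analysis.Analysis" "HOL-Analysis.Cross3"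
begin

unbundle cross3_syntax

section \<open>Grids and difference operators\<close>

datatype grid_domain = Torus | Box

text \<open>
  A multiindex is a function in \<open>{..<n} \<rightarrow>\<^sub>E UNIV\<close>, so that the dimension is an ordinary natural
  number; directions are numbered \<open>0, \<dots>, n - 1\<close>. The values of a grid function outside
  \<open>grid \<Omega> n M\<close> are irrelevant: every operator below first passes to the periodic extension (torus)
  or to the ghost-value extension (box).
\<close>

type_synonym multiindex = "nat \<Rightarrow> int"
type_synonym gridfun = "multiindex \<Rightarrow> real^3"

definition grid :: "grid_domain \<Rightarrow> nat \<Rightarrow> nat \<Rightarrow> multiindex set" where
  "grid \<Omega> n M = {..<n} \<rightarrow>\<^sub>E (case \<Omega> of Torus \<Rightarrow> {0..<int M} | Box \<Rightarrow> {0..int M})"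

fun wrap :: "grid_domain \<Rightarrow> nat \<Rightarrow> int \<Rightarrow> int" where
  "wrap Torus M x = x mod int M"
| "wrap Box M x = (if x = -1 then 0 else if x = int M + 1 then int M else x)"

definition ext :: "grid_domain \<Rightarrow> nat \<Rightarrow> nat \<Rightarrow> gridfun \<Rightarrow> gridfun" where
  "ext \<Omega> n M f = (\<lambda>i. f (\<lambda>j. if j < n then wrap \<Omega> M (i j) else i j))"

definition mesh :: "nat \<Rightarrow> real" where
  "mesh M = 1 / real M"

definition Dplus :: "nat \<Rightarrow> nat \<Rightarrow> gridfun \<Rightarrow> gridfun" where
  "Dplus M j f = (\<lambda>i. (f (i(j := i j + 1)) - f i) /\<^sub>R mesh M)"

definition Dminus :: "nat \<Rightarrow> nat \<Rightarrow> gridfun \<Rightarrow> gridfun" where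
  "Dminus M j f = (\<lambda>i. Dplus M j f (i(j := i j - 1)))"

text \<open>
  In \<open>lap\<close> the function is extended once, before both differences are taken; the difference
  \<open>Dminus\<close> is then defined at the ghost index \<open>M + 1\<close> as well and vanishes there.
\<close>

definition grad :: "grid_domain \<Rightarrow> nat \<Rightarrow> nat \<Rightarrow> gridfun \<Rightarrow> multiindex \<Rightarrow> nat \<Rightarrow> real^3" where
  "grad \<Omega> n M f = (\<lambda>i j. Dminus M j (ext \<Omega> n M f) i)"

definition lap :: "grid_domain \<Rightarrow> nat \<Rightarrow> nat \<Rightarrow> gridfun \<Rightarrow> gridfun" where
  "lap \<Omega> n M f = (\<lambda>i. \<Sum>j<n. Dplus M j (Dminus M j (ext \<Omega> n M f)) i)"

definition grid_integral :: "grid_domain \<Rightarrow> nat \<Rightarrow> nat \<Rightarrow> (multiindex \<Rightarrow> real) \<Rightarrow> real" where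
  "grid_integral \<Omega> n M g = mesh M ^ n * (\<Sum>i\<in>grid \<Omega> n M. g i)"

definition L2norm :: "grid_domain \<Rightarrow> nat \<Rightarrow> nat \<Rightarrow> gridfun \<Rightarrow> real" where
  "L2norm \<Omega> n M f = sqrt (grid_integral \<Omega> n M (\<lambda>i. (norm (f i))\<^sup>2))"

definition L2norm_grad ::
    "grid_domain \<Rightarrow> nat \<Rightarrow> nat \<Rightarrow> (multiindex \<Rightarrow> nat \<Rightarrow> real^3) \<Rightarrow> real" where
  "L2norm_grad \<Omega> n M F = sqrt (grid_integral \<Omega> n M (\<lambda>i. \<Sum>j<n. (norm (F i j))\<^sup>2))"

section \<open>Scheme, energy and fixed point iteration\<close>

definition avg :: "gridfun \<Rightarrow> gridfun \<Rightarrow> gridfun" where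
  "avg f g = (\<lambda>i. (1/2) *\<^sub>R (f i + g i))"

definition scheme ::
    "grid_domain \<Rightarrow> nat \<Rightarrow> nat \<Rightarrow> real \<Rightarrow> (nat \<Rightarrow> gridfun) \<Rightarrow> (nat \<Rightarrow> gridfun) \<Rightarrow> bool" where
  "scheme \<Omega> n M \<Delta>t d w \<longleftrightarrow> (\<forall>m. \<forall>i\<in>grid \<Omega> n M.
     (d (Suc m) i - d m i) /\<^sub>R \<Delta>t = avg (d m) (d (Suc m)) i \<times> avg (w m) (w (Suc m)) i \<and>
     (w (Suc m) i - w m i) /\<^sub>R \<Delta>t
       = lap \<Omega> n M (avg (d m) (d (Suc m))) i \<times> avg (d m) (d (Suc m)) i)"

definition energy :: "grid_domain \<Rightarrow> nat \<Rightarrow> nat \<Rightarrow> gridfun \<Rightarrow> gridfun \<Rightarrow> real" where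
  "energy \<Omega> n M d w = (1/2) * grid_integral \<Omega> n M
     (\<lambda>i. (\<Sum>j<n. (norm (grad \<Omega> n M d i j))\<^sup>2) + (norm (w i))\<^sup>2)"

definition fp_iterates ::
    "grid_domain \<Rightarrow> nat \<Rightarrow> nat \<Rightarrow> real \<Rightarrow> gridfun \<Rightarrow> gridfun \<Rightarrow>
     (nat \<Rightarrow> gridfun) \<Rightarrow> (nat \<Rightarrow> gridfun) \<Rightarrow> bool" where
  "fp_iterates \<Omega> n M \<Delta>t d w D W \<longleftrightarrow>
     (\<forall>i\<in>grid \<Omega> n M. D 0 i = d i \<and> W 0 i = w i) \<and>
     (\<forall>s. \<forall>i\<in>grid \<Omega> n M.
        (D (Suc s) i - d i) /\<^sub>R \<Delta>t = avg d (D (Suc s)) i \<times> avg w (W s) i \<and>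
        (W (Suc s) i - w i) /\<^sub>R \<Delta>t
          = ((1/2) *\<^sub>R (lap \<Omega> n M d i + lap \<Omega> n M (D (Suc s)) i)) \<times> avg d (D (Suc s)) i)"

text \<open>The iterates exist for all data and are uniquely determined on the grid.\<close>

lemma fp_linear_solvable:
  fixes a b :: "real^3"
  assumes "\<Delta>t > 0"
  shows "\<exists>!x. (x - a) /\<^sub>R \<Delta>t = ((1/2) *\<^sub>R (a + x)) \<times> b"
proof -
  define T where "T = (\<lambda>x::real^3. x - (\<Delta>t/2) *\<^sub>R (x \<times> b))"
  have lin: "linear T"
    unfolding T_def
    by (rule linearI)
       (simp_all add: cross_add_left cross_mult_left algebra_simps)
  have inj: "inj T"
  proof (subst linear_injective_0[OF lin], intro allI impI)
    fix x assume "T x = 0"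
    then have x: "x = (\<Delta>t/2) *\<^sub>R (x \<times> b)" by (simp add: T_def)
    have "x \<bullet> x = (\<Delta>t/2) * (x \<bullet> (x \<times> b))"
      by (metis x inner_scaleR_right)
    then show "x = 0" by (simp add: dot_cross_self)
  qed
  have surj: "surj T" using lin inj by (simp add: linear_injective_imp_surjective)
  have eq: "(x - a) /\<^sub>R \<Delta>t = ((1/2) *\<^sub>R (a + x)) \<times> b \<longleftrightarrow> T x = a + (\<Delta>t/2) *\<^sub>R (a \<times> b)" for x
  proof -
    have "(x - a) /\<^sub>R \<Delta>t = ((1/2) *\<^sub>R (a + x)) \<times> b
        \<longleftrightarrow> \<Delta>t *\<^sub>R ((x - a) /\<^sub>R \<Delta>t) = \<Delta>t *\<^sub>R (((1/2) *\<^sub>R (a + x)) \<times> b)"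
      using assms by (subst scaleR_cancel_left) simp
    also have "\<Delta>t *\<^sub>R ((x - a) /\<^sub>R \<Delta>t) = x - a" using assms by simp
    also have "\<Delta>t *\<^sub>R (((1/2) *\<^sub>R (a + x)) \<times> b) = (\<Delta>t/2) *\<^sub>R (a \<times> b) + (\<Delta>t/2) *\<^sub>R (x \<times> b)"
      by (simp add: cross_add_left cross_mult_left scaleR_right_distrib)
    finally show ?thesis by (auto simp: T_def algebra_simps)
  qed
  show ?thesis unfolding eq using inj surj by (metis injD surjD)
qed

lemma ext_cong:
  assumes "\<And>i. i \<in> grid \<Omega> n M \<Longrightarrow> f i = g i" "i \<in> grid \<Omega> n M" "j < n" "c \<in> {-1, 0, 1}" "M > 0"
  shows "ext \<Omega> n M f (i(j := i j + c)) = ext \<Omega> n M g (i(j := i j + c))"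
proof -
  let ?A = "case \<Omega> of Torus \<Rightarrow> {0..<int M} | Box \<Rightarrow> {0..int M}"
  have i: "i l \<in> ?A" if "l < n" for l
    using assms(2) that by (auto simp: grid_def PiE_iff)
  have 1: "wrap \<Omega> M (i l) \<in> ?A" if "l < n" for l
    using i[OF that] by (cases \<Omega>) auto
  have 2: "wrap \<Omega> M (i j + c) \<in> ?A"
    using i[OF assms(3)] assms(4,5) by (cases \<Omega>) auto
  have 3: "i l = undefined" if "\<not> l < n" for l
    using assms(2) that by (auto simp: grid_def PiE_iff extensional_def)
  have "(\<lambda>l. if l < n then wrap \<Omega> M ((i(j := i j + c)) l) else (i(j := i j + c)) l) \<in> grid \<Omega> n M"
    using 1 2 3 assms(3) unfolding grid_def PiE_iff extensional_def by simp
  then show ?thesis unfolding ext_def by (rule assms(1))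
qed

lemma lap_cong:
  assumes "\<And>i. i \<in> grid \<Omega> n M \<Longrightarrow> f i = g i" "i \<in> grid \<Omega> n M" "M > 0"
  shows "lap \<Omega> n M f i = lap \<Omega> n M g i"
proof -
  have "ext \<Omega> n M f (i(j := i j + c)) = ext \<Omega> n M g (i(j := i j + c))"
    if "j < n" "c \<in> {-1, 0, 1}" for j c
    by (rule ext_cong) (use assms that in auto)
  from this[of _ "-1"] this[of _ 0] this[of _ 1] show ?thesis
    unfolding lap_def Dplus_def Dminus_def by (intro sum.cong) auto
qed

lemma fp_iterates_exist:
  assumes "\<Delta>t > 0"
  shows "\<exists>D W. fp_iterates \<Omega> n M \<Delta>t d w D W"
proof -
  define sd where "sd = (\<lambda>ws i. THE x. (x - d i) /\<^sub>R \<Delta>t = ((1/2) *\<^sub>R (d i + x)) \<times> avg w ws i)"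
  define sw where "sw = (\<lambda>d' i. w i + \<Delta>t *\<^sub>R
    (((1/2) *\<^sub>R (lap \<Omega> n M d i + lap \<Omega> n M d' i)) \<times> avg d d' i))"
  define S where "S = rec_nat (d, w) (\<lambda>_ p. (sd (snd p), sw (sd (snd p))))"
  have "fp_iterates \<Omega> n M \<Delta>t d w (\<lambda>s. fst (S s)) (\<lambda>s. snd (S s))"
    using theI'[OF fp_linear_solvable[OF assms]] assms
    by (simp add: fp_iterates_def S_def sd_def sw_def avg_def)
  then show ?thesis by blast
qed

lemma fp_iterates_unique:
  assumes "\<Delta>t > 0" "M > 0"
    and F: "fp_iterates \<Omega> n M \<Delta>t d w D W" and F': "fp_iterates \<Omega> n M \<Delta>t d w D' W'"
  shows "\<forall>i\<in>grid \<Omega> n M. D s i = D' s i \<and> W s i = W' s i"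
proof (induction s)
  case 0
  then show ?case using F F' by (simp add: fp_iterates_def)
next
  case (Suc s)
  have D: "D (Suc s) i = D' (Suc s) i" if "i \<in> grid \<Omega> n M" for i
  proof -
    have "(D (Suc s) i - d i) /\<^sub>R \<Delta>t = ((1/2) *\<^sub>R (d i + D (Suc s) i)) \<times> avg w (W s) i"
         "(D' (Suc s) i - d i) /\<^sub>R \<Delta>t = ((1/2) *\<^sub>R (d i + D' (Suc s) i)) \<times> avg w (W s) i"
      using F F' that Suc by (auto simp: fp_iterates_def avg_def)
    then show ?thesis using fp_linear_solvable[OF assms(1)] by blast
  qed
  have "W (Suc s) i = W' (Suc s) i" if i: "i \<in> grid \<Omega> n M" for i
  proof -
    have "lap \<Omega> n M (D (Suc s)) i = lap \<Omega> n M (D' (Suc s)) i"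
      using D i assms(2) by (rule lap_cong)
    then have "(W (Suc s) i - w i) /\<^sub>R \<Delta>t = (W' (Suc s) i - w i) /\<^sub>R \<Delta>t"
      using F F' i D[OF i] by (simp add: fp_iterates_def avg_def)
    then show ?thesis using assms(1) by simp
  qed
  then show ?case using D by blast
qed

section \<open>Operation counts\<close>

text \<open>
  Computations are straight-line programs over the reals: the \<open>k\<close>-th instruction stores its result
  in register \<open>k\<close>, an operand is an earlier register or an input, and the number of operations is
  the length of the program. Inputs are the grid values, the constant \<open>1\<close> and the discretization
  parameters; all other constants have to be computed. A program that reads an unset register or
  divides by zero has no result.
\<close>

datatype arith_op = Add | Sub | Mul | Div

datatype input = ConstOne | MeshSize | TimeStep | DVal multiindex 3 | WVal multiindex 3

datatype operand = Inp input | Reg nat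

type_synonym program = "(arith_op \<times> operand \<times> operand) list"

fun apply_op :: "arith_op \<Rightarrow> real \<Rightarrow> real \<Rightarrow> real option" where
  "apply_op Add x y = Some (x + y)"
| "apply_op Sub x y = Some (x - y)"
| "apply_op Mul x y = Some (x * y)"
| "apply_op Div x y = (if y = 0 then None else Some (x / y))"

fun operand_val :: "(input \<Rightarrow> real) \<Rightarrow> real list \<Rightarrow> operand \<Rightarrow> real option" where
  "operand_val \<rho> R (Inp v) = Some (\<rho> v)"
| "operand_val \<rho> R (Reg k) = (if k < length R then Some (R ! k) else None)"

fun run :: "(input \<Rightarrow> real) \<Rightarrow> program \<Rightarrow> real list \<Rightarrow> real list option" where
  "run \<rho> [] R = Some R"
| "run \<rho> ((f, a, b) # P) R =
     (case (operand_val \<rho> R a, operand_val \<rho> R b) of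
        (Some x, Some y) \<Rightarrow> (case apply_op f x y of Some z \<Rightarrow> run \<rho> P (R @ [z]) | None \<Rightarrow> None)
      | _ \<Rightarrow> None)"

fun input_val :: "nat \<Rightarrow> real \<Rightarrow> gridfun \<Rightarrow> gridfun \<Rightarrow> input \<Rightarrow> real" where
  "input_val M \<Delta>t d w ConstOne = 1"
| "input_val M \<Delta>t d w MeshSize = mesh M"
| "input_val M \<Delta>t d w TimeStep = \<Delta>t"
| "input_val M \<Delta>t d w (DVal i k) = d i $ k"
| "input_val M \<Delta>t d w (WVal i k) = w i $ k"

text \<open>
  The \<open>s\<close>-th iterate can be computed with at most \<open>c\<close> operations. The program and the assignment
  \<open>od\<close>, \<open>ow\<close> of outputs to operands must not depend on the data \<open>(d, w)\<close>: for fixed data the iterate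
  is a fixed list of numbers, and the notion would be void.
\<close>

definition iterate_computable ::
    "grid_domain \<Rightarrow> nat \<Rightarrow> nat \<Rightarrow> real \<Rightarrow> nat \<Rightarrow> real \<Rightarrow> bool" where
  "iterate_computable \<Omega> n M \<Delta>t s c \<longleftrightarrow>
     (\<exists>(P::program) od ow. real (length P) \<le> c \<and>
        (\<forall>d w D W. fp_iterates \<Omega> n M \<Delta>t d w D W \<longrightarrow>
           (\<exists>R. run (input_val M \<Delta>t d w) P [] = Some R \<and>
              (\<forall>i\<in>grid \<Omega> n M. \<forall>k.
                 operand_val (input_val M \<Delta>t d w) R (od i k) = Some (D s i $ k) \<and>
                 operand_val (input_val M \<Delta>t d w) R (ow i k) = Some (W s i $ k)))))"

end

theory Submission
  imports Defs
begin

text \<open>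
  Everything happens in the supremum norm. The equation for \<open>d\<close> is an implicit rotation, in
  the scheme as well as in the iteration, so that \<open>\<bar>d\<bar>\<close> is conserved at every grid point and stays at
  most one. Two directions obtained with different velocities \<open>v\<close>, \<open>v'\<close>
  differ by at most \<open>(\<Delta>t / 2) \<bar>v - v'\<bar>\<close>, because the part of their difference that is
  rotated by a common velocity is orthogonal to the difference itself (\<open>rotation_diff_le\<close>): large
  velocities do no harm. A discrete Laplacian costs a factor \<open>4 n M\<^sup>2\<close>, and with \<open>\<Delta>t = \<kappa> / M\<close> the new
  velocities differ by at most \<open>2 n \<kappa>\<^sup>2 max \<bar>v - v'\<bar>\<close> (\<open>fp_step_diff_le\<close>). For \<open>\<kappa> \<le> 1/6\<close> this is a
  contraction with factor at most \<open>1/6\<close>, and the exact next time step is its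
  fixed point.

  The initial error is only polynomial in \<open>M\<close>: one time step changes \<open>w\<close> by at most \<open>4 n \<kappa> M\<close>
  (\<open>fp_step_increment_le\<close>). The geometric decay therefore brings it below the tolerance after
  \<open>O(log N)\<close> iterations, the conversion to the norms of the theorem costing a further constant and,
  for the gradient, a factor \<open>M\<close> that the factor \<open>\<Delta>t\<close> in the error of \<open>d\<close> compensates
  (\<open>iterates_converge\<close>).

  Each iteration takes boundedly many operations per grid point. The linear equation for the new
  direction is a \<open>3 \<times> 3\<close> system with an explicit rational solution (\<open>cross_equation_solution\<close>), and
  the new velocity is an explicit expression in the values at the neighbouring points. Programs are
  composed with a relation \<open>reach S c T\<close>, which says that \<open>c\<close> instructions suffice to get from the
  values \<open>S\<close> to the values \<open>T\<close>; iterating it over the grid and over the iterations gives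
  \<open>O(N log N)\<close> operations (\<open>reach_iterate\<close>).
\<close>

section \<open>Pointwise estimates for the implicit equations\<close>

lemma norm_cross_le: "norm (x \<times> y) \<le> norm x * norm y"
proof -
  have "(norm (x \<times> y))\<^sup>2 \<le> (norm x * norm y)\<^sup>2"
    using norm_cross_dot[of x y] zero_le_power2[of "x \<bullet> y"] by linarith
  then show ?thesis by (rule power2_le_imp_le) simp
qed

lemma scaled_eq_iff:
  fixes x a b :: "'a::real_vector"
  assumes "\<Delta>t > 0"
  shows "(x - a) /\<^sub>R \<Delta>t = b \<longleftrightarrow> x = a + \<Delta>t *\<^sub>R b"
proof -
  have "(x - a) /\<^sub>R \<Delta>t = b \<longleftrightarrow> \<Delta>t *\<^sub>R ((x - a) /\<^sub>R \<Delta>t) = \<Delta>t *\<^sub>R b"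
    using assms by (subst scaleR_cancel_left) simp
  also have "\<dots> \<longleftrightarrow> x = a + \<Delta>t *\<^sub>R b" using assms by (auto simp: algebra_simps)
  finally show ?thesis .
qed

lemma midpoint_equation:
  fixes x a b :: "real^3"
  assumes "x = a + t *\<^sub>R (((1/2) *\<^sub>R (a + x)) \<times> b)"
  shows "x = a + a \<times> ((t * (1/2)) *\<^sub>R b) + x \<times> ((t * (1/2)) *\<^sub>R b)"
  using assms
  by (simp add: cross_mult_left cross_mult_right cross_add_left scaleR_right_distrib add.assoc)

text \<open>The increment \<open>x - a\<close> is orthogonal to \<open>x + a\<close>.\<close>

lemma rotation_norm_eq:
  fixes x a p :: "real^3"
  assumes "x = a + t *\<^sub>R (((1/2) *\<^sub>R (a + x)) \<times> p)"
  shows "norm x = norm a"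
proof -
  have "(x - a) \<bullet> (x + a) = (t/2) * (((a + x) \<times> p) \<bullet> (a + x))"
  proof -
    have "x - a = (t/2) *\<^sub>R ((a + x) \<times> p)"
      using assms by (metis add_diff_cancel_left' cross_mult_left scaleR_scaleR times_divide_eq_right mult.right_neutral)
    then show ?thesis by (simp add: add.commute)
  qed
  also have "\<dots> = 0" by (simp add: dot_cross_self)
  finally have "x \<bullet> x = a \<bullet> a" by (simp add: algebra_simps inner_commute)
  then show ?thesis by (simp add: norm_eq)
qed

text \<open>
  Split the difference of the two cross products into \<open>(x - x') \<times> (b + v)\<close> and
  \<open>(a + x') \<times> (v - v')\<close>. The first vanishes against \<open>x - x'\<close>, so that the size of \<open>b\<close>, \<open>v\<close> and \<open>v'\<close>
  does not enter the bound.
\<close>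

lemma rotation_diff_le:
  fixes x x' a b v v' :: "real^3"
  assumes x: "x = a + t *\<^sub>R (((1/2) *\<^sub>R (a + x)) \<times> ((1/2) *\<^sub>R (b + v)))"
    and x': "x' = a + t *\<^sub>R (((1/2) *\<^sub>R (a + x')) \<times> ((1/2) *\<^sub>R (b + v')))"
    and a: "norm a \<le> 1" and t: "t \<ge> 0"
  shows "norm (x - x') \<le> t / 2 * norm (v - v')"
proof -
  define y where "y = x - x'"
  have y: "y = (t/4) *\<^sub>R (y \<times> (b + v)) + (t/4) *\<^sub>R ((a + x') \<times> (v - v'))"
  proof -
    have "y = (t/4) *\<^sub>R ((a + x) \<times> (b + v)) - (t/4) *\<^sub>R ((a + x') \<times> (b + v'))"
      unfolding y_def by (subst x, subst x') (simp add: cross_mult_left cross_mult_right)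
    also have "(a + x) \<times> (b + v) = y \<times> (b + v) + (a + x') \<times> (b + v)"
      by (simp add: y_def cross_add_left[symmetric] add.commute)
    also have "(a + x') \<times> (b + v) = (a + x') \<times> (b + v') + (a + x') \<times> (v - v')"
      by (simp add: cross_add_right[symmetric])
    finally show ?thesis by (simp add: scaleR_right_distrib)
  qed
  have "(norm y)\<^sup>2 = y \<bullet> ((t/4) *\<^sub>R (y \<times> (b + v)) + (t/4) *\<^sub>R ((a + x') \<times> (v - v')))"
    using y by (metis power2_norm_eq_inner)
  also have "\<dots> = (t/4) * (y \<bullet> ((a + x') \<times> (v - v')))"
    by (simp add: inner_add_right dot_cross_self)
  also have "\<dots> \<le> (t/4) * (norm y * (2 * norm (v - v')))"
  proof (intro mult_left_mono)
    have "y \<bullet> ((a + x') \<times> (v - v')) \<le> norm y * norm ((a + x') \<times> (v - v'))"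
      by (rule norm_cauchy_schwarz)
    also have "norm ((a + x') \<times> (v - v')) \<le> norm (a + x') * norm (v - v')"
      by (rule norm_cross_le)
    also have "norm (a + x') \<le> 2"
      using norm_triangle_ineq[of a x'] rotation_norm_eq[OF x'] a by linarith
    finally show "y \<bullet> ((a + x') \<times> (v - v')) \<le> norm y * (2 * norm (v - v'))"
      by (simp add: mult_left_mono mult_right_mono)
  qed (use t in simp)
  finally have "norm y * norm y \<le> norm y * (t / 2 * norm (v - v'))"
    by (simp add: power2_eq_square mult.commute mult.left_commute)
  then have "norm y \<le> t / 2 * norm (v - v')"
    using t by (cases "y = 0") (auto simp: mult_le_cancel_left)
  then show ?thesis by (simp add: y_def)
qed

text \<open>
  Eliminating \<open>x\<close> from \<open>x - x \<times> c = r\<close> by taking the inner and the cross product with \<open>c\<close> gives a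
  formula whose only denominator is at least one.
\<close>

lemma cross_equation_solution:
  fixes x r c :: "real^3"
  assumes "x = r + x \<times> c"
  shows "x = (1 / (1 + c \<bullet> c)) *\<^sub>R (r + r \<times> c + (r \<bullet> c) *\<^sub>R c)"
proof -
  have "1 + c \<bullet> c > 0" by (simp add: add_pos_nonneg)
  have r: "r = x - x \<times> c" using assms by (simp add: algebra_simps)
  have "r + r \<times> c + (r \<bullet> c) *\<^sub>R c = (1 + c \<bullet> c) *\<^sub>R x"
    unfolding r
    by (simp add: vec_eq_iff forall_3 cross3_simps inner_vec_def sum_3)
  then show ?thesis using \<open>1 + c \<bullet> c > 0\<close> by simp
qed

section \<open>Grid operators in the supremum norm\<close>

lemma finite_grid: "finite (grid \<Omega> n M)"
  unfolding grid_def by (rule finite_PiE) (auto split: grid_domain.split)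

lemma card_grid_le:
  assumes "M \<ge> 1" "n \<le> 3"
  shows "real (card (grid \<Omega> n M)) \<le> 8 * real M ^ n"
proof -
  have "card (grid \<Omega> n M) \<le> (2 * M) ^ n"
  proof (cases \<Omega>)
    case Torus
    then show ?thesis by (simp add: grid_def card_PiE power_mono)
  next
    case Box
    have "Suc M ^ n \<le> (2 * M) ^ n" using assms(1) by (intro power_mono) auto
    with Box show ?thesis by (simp add: grid_def card_PiE nat_add_distrib)
  qed
  also have "\<dots> = 2 ^ n * M ^ n" by (rule power_mult_distrib)
  also have "\<dots> \<le> 2 ^ 3 * M ^ n"
    using assms(2) by (intro mult_right_mono power_increasing) auto
  finally show ?thesis using of_nat_mono by fastforce
qed

text \<open>
  Extended values next to a grid point are grid values, at a point that does not depend on the grid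
  function; so they obey the same bounds and are available to programs at no cost.
\<close>

lemma ext_neighbour:
  assumes "i \<in> grid \<Omega> n M" "j < n" "c \<in> {-1, 0, 1}" "M > 0"
  obtains i' where "i' \<in> grid \<Omega> n M" "\<And>f. ext \<Omega> n M f (i(j := i j + c)) = f i'"
proof -
  let ?A = "case \<Omega> of Torus \<Rightarrow> {0..<int M} | Box \<Rightarrow> {0..int M}"
  let ?i = "\<lambda>l. if l < n then wrap \<Omega> M ((i(j := i j + c)) l) else (i(j := i j + c)) l"
  have i: "i l \<in> ?A" if "l < n" for l
    using assms(1) that by (auto simp: grid_def PiE_iff)
  have 1: "wrap \<Omega> M (i l) \<in> ?A" if "l < n" for l
    using i[OF that] by (cases \<Omega>) auto
  have 2: "wrap \<Omega> M (i j + c) \<in> ?A"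
    using i[OF assms(2)] assms(3,4) by (cases \<Omega>) auto
  have 3: "i l = undefined" if "\<not> l < n" for l
    using assms(1) that by (auto simp: grid_def PiE_iff extensional_def)
  have "?i \<in> grid \<Omega> n M"
    using 1 2 3 assms(2) unfolding grid_def PiE_iff extensional_def by simp
  moreover have "ext \<Omega> n M f (i(j := i j + c)) = f ?i" for f
    by (simp add: ext_def)
  ultimately show thesis by (rule that)
qed

lemma lap_eq:
  "lap \<Omega> n M f i = (\<Sum>j<n. (1 / (mesh M * mesh M)) *\<^sub>R
     ((ext \<Omega> n M f (i(j := i j + 1)) - ext \<Omega> n M f (i(j := i j + 0)))
      - (ext \<Omega> n M f (i(j := i j + 0)) - ext \<Omega> n M f (i(j := i j + -1)))))"
  unfolding lap_def Dplus_def Dminus_def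
  by (intro sum.cong) (simp_all add: scaleR_diff_right[symmetric] divide_inverse)

lemma ext_diff: "ext \<Omega> n M (\<lambda>i. f i - g i) i = ext \<Omega> n M f i - ext \<Omega> n M g i"
  by (simp add: ext_def)

lemma lap_diff: "lap \<Omega> n M (\<lambda>i. f i - g i) i = lap \<Omega> n M f i - lap \<Omega> n M g i"
  unfolding lap_eq ext_diff sum_subtractf[symmetric] scaleR_diff_right[symmetric]
  by (intro sum.cong refl arg_cong[where f = "scaleR _"]) simp

lemma lap_avg:
  "lap \<Omega> n M (avg f g) i = (1/2) *\<^sub>R (lap \<Omega> n M f i + lap \<Omega> n M g i)"
proof -
  have e: "ext \<Omega> n M (avg f g) i = (1/2) *\<^sub>R (ext \<Omega> n M f i + ext \<Omega> n M g i)" for i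
    by (simp add: ext_def avg_def)
  show ?thesis
    unfolding lap_eq e sum.distrib[symmetric] scaleR_sum_right
    by (intro sum.cong refl)
      (simp only: scaleR_add_right scaleR_diff_right scaleR_left_commute[of "1/2"],
       simp only: diff_conv_add_uminus minus_add_distrib minus_minus add_ac)
qed

lemma norm_ext_le:
  assumes "\<forall>i\<in>grid \<Omega> n M. norm (f i) \<le> B" "i \<in> grid \<Omega> n M" "j < n" "c \<in> {-1, 0, 1}" "M > 0"
  shows "norm (ext \<Omega> n M f (i(j := i j + c))) \<le> B"
  proof -
  obtain i' where "i' \<in> grid \<Omega> n M" "\<And>f. ext \<Omega> n M f (i(j := i j + c)) = f i'"
    using ext_neighbour[OF assms(2-5)] by blast
  then show ?thesis using assms(1) by simp
qed

lemma norm_lap_le: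
  assumes B: "\<forall>i\<in>grid \<Omega> n M. norm (f i) \<le> B" and i: "i \<in> grid \<Omega> n M" and M: "M > 0"
  shows "norm (lap \<Omega> n M f i) \<le> 4 * real n * (real M)\<^sup>2 * B"
proof -
  have "norm ((1 / (mesh M * mesh M)) *\<^sub>R
     ((ext \<Omega> n M f (i(j := i j + 1)) - ext \<Omega> n M f (i(j := i j + 0)))
      - (ext \<Omega> n M f (i(j := i j + 0)) - ext \<Omega> n M f (i(j := i j + -1))))) \<le> (real M)\<^sup>2 * (4 * B)"
    (is "norm (_ *\<^sub>R ?v) \<le> _") if "j < n" for j
  proof -
    let ?e = "\<lambda>c. ext \<Omega> n M f (i(j := i j + c))"
    have "norm ?v \<le> 4 * B"
      using norm_ext_le[OF B i that _ M, of 1] norm_ext_le[OF B i that _ M, of 0]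
        norm_ext_le[OF B i that _ M, of "-1"]
        norm_triangle_ineq4[of "?e 1 - ?e 0" "?e 0 - ?e (-1)"]
        norm_triangle_ineq4[of "?e 1" "?e 0"] norm_triangle_ineq4[of "?e 0" "?e (-1)"]
      by (simp del: add_0_right fun_upd_triv)
    moreover have "1 / (mesh M * mesh M) = (real M)\<^sup>2"
      by (simp add: mesh_def power2_eq_square)
    ultimately show ?thesis by (simp add: mult_left_mono)
  qed
  then have "norm (lap \<Omega> n M f i) \<le> (\<Sum>j<n. (real M)\<^sup>2 * (4 * B))"
    unfolding lap_eq by (intro sum_norm_le) auto
  then show ?thesis by (simp add: mult_ac)
qed

lemma grid_integral_le:
  assumes "\<forall>i\<in>grid \<Omega> n M. g i \<le> B" "B \<ge> 0" "M \<ge> 1" "n \<le> 3"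
  shows "grid_integral \<Omega> n M g \<le> 8 * B"
proof -
  have "(\<Sum>i\<in>grid \<Omega> n M. g i) \<le> real (card (grid \<Omega> n M)) * B"
    using assms(1) by (intro sum_bounded_above) auto
  also have "\<dots> \<le> 8 * real M ^ n * B"
    using card_grid_le[OF assms(3,4)] assms(2) by (rule mult_right_mono)
  finally have "mesh M ^ n * (\<Sum>i\<in>grid \<Omega> n M. g i) \<le> mesh M ^ n * (8 * real M ^ n * B)"
    by (rule mult_left_mono) (simp add: mesh_def)
  also have "\<dots> = 8 * B" using assms(3) by (simp add: mesh_def power_one_over)
  finally show ?thesis by (simp add: grid_integral_def)
qed

lemma L2norm_le_sup:
  assumes "\<forall>i\<in>grid \<Omega> n M. norm (f i) \<le> B" "B \<ge> 0" "M \<ge> 1" "n \<le> 3"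
  shows "L2norm \<Omega> n M f \<le> 3 * B"
proof -
  have "grid_integral \<Omega> n M (\<lambda>i. (norm (f i))\<^sup>2) \<le> 8 * B\<^sup>2"
    using assms by (intro grid_integral_le) (auto intro: power_mono)
  also have "\<dots> \<le> (3 * B)\<^sup>2" by (simp add: power_mult_distrib)
  finally show ?thesis unfolding L2norm_def using assms(2) by (intro real_le_lsqrt) auto
qed

text \<open>The inverse inequality: on a grid of mesh \<open>1 / M\<close> a difference quotient costs a factor \<open>2 M\<close>.\<close>

lemma L2norm_grad_le_sup:
  assumes B: "\<forall>i\<in>grid \<Omega> n M. norm (f i - g i) \<le> B" and "B \<ge> 0" "M \<ge> 1" "n \<le> 3"
  shows "L2norm_grad \<Omega> n M (\<lambda>i j. grad \<Omega> n M f i j - grad \<Omega> n M g i j) \<le> 10 * real M * B"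
proof -
  let ?F = "\<lambda>i j. grad \<Omega> n M f i j - grad \<Omega> n M g i j"
  have F: "(norm (?F i j))\<^sup>2 \<le> (2 * real M * B)\<^sup>2" if i: "i \<in> grid \<Omega> n M" and j: "j < n" for i j
  proof -
    let ?e = "ext \<Omega> n M (\<lambda>i. f i - g i)"
    have M: "M > 0" using assms(3) by simp
    have F: "?F i j = (?e (i(j := i j + 0)) - ?e (i(j := i j + -1))) /\<^sub>R mesh M"
      by (simp add: grad_def Dminus_def Dplus_def ext_diff scaleR_diff_right)
    have "norm (?F i j) = real M * norm (?e (i(j := i j + 0)) - ?e (i(j := i j + -1)))"
      unfolding F by (simp add: mesh_def)
    also have "\<dots> \<le> real M * (2 * B)"
    proof (rule mult_left_mono)
      show "norm (?e (i(j := i j + 0)) - ?e (i(j := i j + -1))) \<le> 2 * B"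
      proof -
        have "norm (?e (i(j := i j + 0))) \<le> B" "norm (?e (i(j := i j + -1))) \<le> B"
          by (rule norm_ext_le[OF B i j _ M], simp)+
        then show ?thesis
          using norm_triangle_ineq4[of "?e (i(j := i j + 0))" "?e (i(j := i j + -1))"] by linarith
      qed
    qed simp
    finally have "norm (?F i j) \<le> 2 * real M * B" by (simp only: mult_ac)
    then show ?thesis by (rule power_mono) simp
  qed
  have "(\<Sum>j<n. (norm (?F i j))\<^sup>2) \<le> 12 * (real M * B)\<^sup>2" if "i \<in> grid \<Omega> n M" for i
  proof -
    have "(\<Sum>j<n. (norm (?F i j))\<^sup>2) \<le> real n * (2 * real M * B)\<^sup>2"
      using sum_bounded_above[of "{..<n}" "\<lambda>j. (norm (?F i j))\<^sup>2"] F[OF that] by simp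
    also have "\<dots> \<le> 3 * (2 * real M * B)\<^sup>2" using assms(4) by (intro mult_right_mono) auto
    finally show ?thesis by (simp add: power_mult_distrib)
  qed
  then have "grid_integral \<Omega> n M (\<lambda>i. \<Sum>j<n. (norm (?F i j))\<^sup>2) \<le> 8 * (12 * (real M * B)\<^sup>2)"
    using assms by (intro grid_integral_le) auto
  also have "\<dots> \<le> (10 * real M * B)\<^sup>2" by (simp add: power_mult_distrib)
  finally show ?thesis unfolding L2norm_grad_def using assms(2) by (intro real_le_lsqrt) auto
qed

section \<open>The contraction\<close>

text \<open>
  One step of the fixed point iteration with given velocity \<open>v\<close>. A time step of the scheme is the
  same map with \<open>v = w'\<close>, so that a single difference estimate covers both the increments and the
  errors of the iteration.
\<close>

definition fp_step ::
    "grid_domain \<Rightarrow> nat \<Rightarrow> nat \<Rightarrow> real \<Rightarrow> gridfun \<Rightarrow> gridfun \<Rightarrow> gridfun \<Rightarrow> gridfun \<Rightarrow> gridfun \<Rightarrow> bool" where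
  "fp_step \<Omega> n M \<Delta>t d w v d' w' \<longleftrightarrow> (\<forall>i\<in>grid \<Omega> n M.
     d' i = d i + \<Delta>t *\<^sub>R (((1/2) *\<^sub>R (d i + d' i)) \<times> ((1/2) *\<^sub>R (w i + v i))) \<and>
     w' i = w i + \<Delta>t *\<^sub>R
       (((1/2) *\<^sub>R (lap \<Omega> n M d i + lap \<Omega> n M d' i)) \<times> ((1/2) *\<^sub>R (d i + d' i))))"

lemma fp_step_scheme:
  assumes "\<Delta>t > 0" "scheme \<Omega> n M \<Delta>t d w"
  shows "fp_step \<Omega> n M \<Delta>t (d m) (w m) (w (Suc m)) (d (Suc m)) (w (Suc m))"
  using assms(2) unfolding scheme_def fp_step_def scaled_eq_iff[OF assms(1)] lap_avg
  unfolding avg_def by blast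

lemma fp_step_iterates:
  assumes "\<Delta>t > 0" "fp_iterates \<Omega> n M \<Delta>t d w D W"
  shows "fp_step \<Omega> n M \<Delta>t d w (W s) (D (Suc s)) (W (Suc s))"
  using assms(2) unfolding fp_iterates_def fp_step_def scaled_eq_iff[OF assms(1)]
  by (simp add: avg_def)

lemma fp_step_norm_eq:
  assumes "fp_step \<Omega> n M \<Delta>t d w v d' w'" "i \<in> grid \<Omega> n M"
  shows "norm (d' i) = norm (d i)"
  using assms unfolding fp_step_def by (blast intro: rotation_norm_eq)

lemma scheme_norm_le_1:
  assumes "\<Delta>t > 0" "scheme \<Omega> n M \<Delta>t d w" "\<forall>i\<in>grid \<Omega> n M. norm (d 0 i) \<le> 1"
  shows "\<forall>i\<in>grid \<Omega> n M. norm (d m i) \<le> 1"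
proof (induction m)
  case (Suc m)
  then show ?case using fp_step_norm_eq[OF fp_step_scheme[OF assms(1,2)]] by simp
qed (use assms in simp)

lemma norm_average_le:
  fixes x y :: "'a::real_normed_vector"
  assumes "norm x \<le> B" "norm y \<le> B"
  shows "norm ((1/2) *\<^sub>R (x + y)) \<le> B"
  using norm_triangle_ineq[of x y] assms by simp

text \<open>
  The contraction factor depends only on \<open>n\<close> and \<open>\<kappa> = M \<Delta>t\<close>: the vectors \<open>d\<close> keep their
  length, so \<open>\<bar>\<Delta>\<^sub>h d\<bar> \<le> 4 n M\<^sup>2\<close> pointwise, and the same factor bounds the discrete Laplacian of the
  difference of two directions, which is itself of size \<open>\<Delta>t / 2\<close> times the difference of the
  velocities.
\<close>

lemma fp_step_diff_le:
  assumes p1: "fp_step \<Omega> n M \<Delta>t d w v\<^sub>1 d\<^sub>1 w\<^sub>1" and p2: "fp_step \<Omega> n M \<Delta>t d w v\<^sub>2 d\<^sub>2 w\<^sub>2"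
    and d: "\<forall>i\<in>grid \<Omega> n M. norm (d i) \<le> 1" and t: "\<Delta>t \<ge> 0" and M: "M > 0"
    and v: "\<forall>i\<in>grid \<Omega> n M. norm (v\<^sub>1 i - v\<^sub>2 i) \<le> B"
    and i: "i \<in> grid \<Omega> n M"
  shows "norm (d\<^sub>1 i - d\<^sub>2 i) \<le> \<Delta>t / 2 * B"
    and "norm (w\<^sub>1 i - w\<^sub>2 i) \<le> 2 * real n * (real M * \<Delta>t)\<^sup>2 * B"
proof -
  have dd: "\<forall>i\<in>grid \<Omega> n M. norm (d\<^sub>1 i - d\<^sub>2 i) \<le> \<Delta>t / 2 * B"
  proof
    fix i assume i: "i \<in> grid \<Omega> n M"
    have "norm (d\<^sub>1 i - d\<^sub>2 i) \<le> \<Delta>t / 2 * norm (v\<^sub>1 i - v\<^sub>2 i)"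
      using p1 p2 i d t unfolding fp_step_def by (blast intro: rotation_diff_le)
    also have "\<dots> \<le> \<Delta>t / 2 * B" using v i t by (intro mult_left_mono) auto
    finally show "norm (d\<^sub>1 i - d\<^sub>2 i) \<le> \<Delta>t / 2 * B" .
  qed
  show "norm (d\<^sub>1 i - d\<^sub>2 i) \<le> \<Delta>t / 2 * B" using dd i by blast
  let ?L = "lap \<Omega> n M" and ?c = "4 * real n * (real M)\<^sup>2"
  have d1: "\<forall>i\<in>grid \<Omega> n M. norm (d\<^sub>1 i) \<le> 1"
    using fp_step_norm_eq[OF p1] d by simp
  have d2: "\<forall>i\<in>grid \<Omega> n M. norm (d\<^sub>2 i) \<le> 1"
    using fp_step_norm_eq[OF p2] d by simp
  have L: "norm ((1/2) *\<^sub>R (?L d i + ?L d\<^sub>2 i)) \<le> ?c"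
    using norm_lap_le[OF d i M] norm_lap_le[OF d2 i M] by (intro norm_average_le) auto
  have LL: "norm (?L d\<^sub>1 i - ?L d\<^sub>2 i) \<le> ?c * (\<Delta>t / 2 * B)"
    using norm_lap_le[OF dd i M] by (simp add: lap_diff)
  have a: "norm ((1/2) *\<^sub>R (d i + d\<^sub>1 i)) \<le> 1"
    using d d1 i by (intro norm_average_le) auto
  have c0: "?c \<ge> 0" by simp
  let ?X = "((1/2) *\<^sub>R (?L d\<^sub>1 i - ?L d\<^sub>2 i)) \<times> ((1/2) *\<^sub>R (d i + d\<^sub>1 i))"
  let ?Y = "((1/2) *\<^sub>R (?L d i + ?L d\<^sub>2 i)) \<times> ((1/2) *\<^sub>R (d\<^sub>1 i - d\<^sub>2 i))"
  have "w\<^sub>1 i - w\<^sub>2 i = \<Delta>t *\<^sub>R (?X + ?Y)"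
  proof -
    let ?P = "\<lambda>e. ((1/2) *\<^sub>R (?L d i + ?L e i)) \<times> ((1/2) *\<^sub>R (d i + e i))"
    have "w\<^sub>1 i - w\<^sub>2 i = \<Delta>t *\<^sub>R (?P d\<^sub>1 - ?P d\<^sub>2)"
      using p1 p2 i unfolding fp_step_def by (simp add: scaleR_diff_right)
    also have "?P d\<^sub>1 - ?P d\<^sub>2 = ?X + ?Y"
      by (simp add: cross_add_left cross_add_right cross_mult_left cross_mult_right
          left_diff_distrib right_diff_distrib algebra_simps Cross3.left_diff_distrib Cross3.right_diff_distrib)
    finally show ?thesis .
  qed
  then have "norm (w\<^sub>1 i - w\<^sub>2 i) \<le> \<Delta>t * (norm ?X + norm ?Y)"
    using t by (simp add: mult_left_mono norm_triangle_ineq)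
  also have "norm ?X \<le> (1/2 * (?c * (\<Delta>t / 2 * B))) * 1"
  proof (rule order_trans[OF norm_cross_le], rule mult_mono)
    show "norm ((1/2) *\<^sub>R (?L d\<^sub>1 i - ?L d\<^sub>2 i)) \<le> 1/2 * (?c * (\<Delta>t / 2 * B))" using LL by simp
    then show "0 \<le> 1/2 * (?c * (\<Delta>t / 2 * B))" by (rule order_trans[OF norm_ge_zero])
  qed (use a in auto)
  also have "norm ?Y \<le> ?c * (1/2 * (\<Delta>t / 2 * B))"
    using L dd i c0 by (intro order_trans[OF norm_cross_le] mult_mono) auto
  finally have "norm (w\<^sub>1 i - w\<^sub>2 i)
      \<le> \<Delta>t * ((1/2 * (?c * (\<Delta>t / 2 * B))) * 1 + ?c * (1/2 * (\<Delta>t / 2 * B)))"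
    using t by (simp add: mult_left_mono)
  then show "norm (w\<^sub>1 i - w\<^sub>2 i) \<le> 2 * real n * (real M * \<Delta>t)\<^sup>2 * B"
    by (simp add: power2_eq_square algebra_simps)
qed

lemma fp_step_increment_le:
  assumes p: "fp_step \<Omega> n M \<Delta>t d w v d' w'"
    and d: "\<forall>i\<in>grid \<Omega> n M. norm (d i) \<le> 1" and t: "\<Delta>t \<ge> 0" and M: "M > 0"
    and i: "i \<in> grid \<Omega> n M"
  shows "norm (w' i - w i) \<le> \<Delta>t * (4 * real n * (real M)\<^sup>2)"
proof -
  let ?L = "lap \<Omega> n M" and ?c = "4 * real n * (real M)\<^sup>2"
  have d': "\<forall>i\<in>grid \<Omega> n M. norm (d' i) \<le> 1"
    using fp_step_norm_eq[OF p] d by simp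
  have "norm ((1/2) *\<^sub>R (?L d i + ?L d' i)) \<le> ?c"
    using norm_lap_le[OF d i M] norm_lap_le[OF d' i M] by (intro norm_average_le) auto
  moreover have "norm ((1/2) *\<^sub>R (d i + d' i)) \<le> 1"
    using d d' i by (intro norm_average_le) auto
  ultimately have "norm (((1/2) *\<^sub>R (?L d i + ?L d' i)) \<times> ((1/2) *\<^sub>R (d i + d' i))) \<le> ?c * 1"
    by (intro order_trans[OF norm_cross_le] mult_mono) auto
  moreover have "w' i - w i
      = \<Delta>t *\<^sub>R (((1/2) *\<^sub>R (?L d i + ?L d' i)) \<times> ((1/2) *\<^sub>R (d i + d' i)))"
    using p i unfolding fp_step_def by simp
  ultimately show ?thesis using t by (simp add: mult_left_mono)
qed

text \<open>
  With \<open>\<kappa> \<le> 1/6\<close> and \<open>n \<le> 3\<close> the contraction factor \<open>2 n \<kappa>\<^sup>2\<close> is at most \<open>1/6\<close>, and the initial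
  error \<open>4 n \<kappa> M\<close> is at most \<open>2 M\<close>.
\<close>

lemma iterate_errors_le:
  assumes \<kappa>: "0 < \<kappa>" "\<kappa> \<le> 1/6" and n: "n \<le> 3" and M: "M > 0" and t: "\<Delta>t = \<kappa> * mesh M"
    and p: "fp_step \<Omega> n M \<Delta>t d w w' d' w'" and F: "fp_iterates \<Omega> n M \<Delta>t d w D W"
    and d: "\<forall>i\<in>grid \<Omega> n M. norm (d i) \<le> 1"
  shows "\<forall>i\<in>grid \<Omega> n M. norm (w' i - W s i) \<le> 2 * real M * (1/6)^s"
    and "\<forall>i\<in>grid \<Omega> n M. norm (d' i - D (Suc s) i) \<le> \<Delta>t / 2 * (2 * real M * (1/6)^s)"
proof -
  have t0: "\<Delta>t > 0" using t \<kappa> M by (simp add: mesh_def)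
  have Mt: "real M * \<Delta>t = \<kappa>" using t M by (simp add: mesh_def)
  have w: "\<forall>i\<in>grid \<Omega> n M. norm (w' i - W s i) \<le> 2 * real M * (1/6)^s" for s
  proof (induction s)
    case 0
    show ?case
    proof
      fix i assume i: "i \<in> grid \<Omega> n M"
      have "norm (w' i - W 0 i) \<le> \<Delta>t * (4 * real n * (real M)\<^sup>2)"
        using fp_step_increment_le[OF p d _ M i] t0 F i by (simp add: fp_iterates_def)
      also have "\<dots> = 4 * (real n * (real M * \<Delta>t)) * real M"
        by (simp add: power2_eq_square)
      also have "\<dots> \<le> 4 * (3 * (1/6)) * real M"
        unfolding Mt using \<kappa> n by (intro mult_right_mono mult_left_mono mult_mono) auto
      finally show "norm (w' i - W 0 i) \<le> 2 * real M * (1/6)^0" by simp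
    qed
  next
    case (Suc s)
    show ?case
    proof
      fix i assume i: "i \<in> grid \<Omega> n M"
      have "norm (w' i - W (Suc s) i)
          \<le> 2 * real n * (real M * \<Delta>t)\<^sup>2 * (2 * real M * (1/6)^s)"
        by (rule fp_step_diff_le(2)[OF p fp_step_iterates[OF t0 F] d _ M Suc.IH i])
          (use t0 in simp)
      also have "\<dots> \<le> (2 * 3 * (1/6)\<^sup>2) * (2 * real M * (1/6)^s)"
        unfolding Mt using \<kappa> n by (intro mult_right_mono mult_mono power_mono) auto
      finally show "norm (w' i - W (Suc s) i) \<le> 2 * real M * (1/6)^Suc s"
        by (simp add: power2_eq_square)
    qed
  qed
  show "\<forall>i\<in>grid \<Omega> n M. norm (w' i - W s i) \<le> 2 * real M * (1/6)^s" by (rule w)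
  show "\<forall>i\<in>grid \<Omega> n M. norm (d' i - D (Suc s) i) \<le> \<Delta>t / 2 * (2 * real M * (1/6)^s)"
    using fp_step_diff_le(1)[OF p fp_step_iterates[OF t0 F] d _ M w] t0 by auto
qed

text \<open>
  One factor \<open>M\<close> lost to the gradient cancels against \<open>\<Delta>t = \<kappa> / M\<close>; the remaining factor \<open>M\<close> is
  that of the initial error.
\<close>

lemma iterates_converge:
  assumes \<kappa>: "0 < \<kappa>" "\<kappa> \<le> 1/6" and n: "n \<le> 3" and M: "M \<ge> 1" and t: "\<Delta>t = \<kappa> * mesh M"
    and p: "fp_step \<Omega> n M \<Delta>t d w w' d' w'" and F: "fp_iterates \<Omega> n M \<Delta>t d w D W"
    and d: "\<forall>i\<in>grid \<Omega> n M. norm (d i) \<le> 1" and s: "s \<ge> 1"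
  shows "L2norm \<Omega> n M (\<lambda>i. w' i - W s i)
          + L2norm_grad \<Omega> n M (\<lambda>i j. grad \<Omega> n M d' i j - grad \<Omega> n M (D s) i j)
         \<le> 32 * real M * (1/6)^s"
    and "L2norm \<Omega> n M (\<lambda>i. W (s + 1) i - W s i)
          + L2norm_grad \<Omega> n M (\<lambda>i j. grad \<Omega> n M (D (s + 1)) i j - grad \<Omega> n M (D s) i j)
         \<le> 32 * real M * (1/6)^s"
proof -
  obtain r where r: "s = Suc r" using s by (cases s) auto
  have M': "M > 0" using M by simp
  have t0: "\<Delta>t > 0" using t \<kappa> M by (simp add: mesh_def)
  have Mt: "real M * \<Delta>t = \<kappa>" using t M by (simp add: mesh_def)
  define B where "B = 2 * real M * (1/6::real)^s"
  define E where "E = \<Delta>t / 2 * (2 * real M * (1/6::real)^r)"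
  have BE: "B \<ge> 0" "E \<ge> 0" using t0 by (auto simp: B_def E_def)
  note err = iterate_errors_le[OF \<kappa> n M' t p F d]
  have wB: "\<forall>i\<in>grid \<Omega> n M. norm (w' i - W s i) \<le> B"
    using err(1)[of s] by (simp add: B_def)
  have wB': "\<forall>i\<in>grid \<Omega> n M. norm (w' i - W (s + 1) i) \<le> B"
  proof -
    have "2 * real M * (1/6)^(s + 1) \<le> B" by (simp add: B_def)
    then show ?thesis using err(1)[of "s + 1"] by (meson order_trans)
  qed
  have dE: "\<forall>i\<in>grid \<Omega> n M. norm (d' i - D s i) \<le> E"
    using err(2)[of r] by (simp add: E_def r)
  have dE': "\<forall>i\<in>grid \<Omega> n M. norm (d' i - D (s + 1) i) \<le> E"
  proof -
    have "\<Delta>t / 2 * (2 * real M * (1/6)^s) \<le> E"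
      unfolding E_def r using t0 by (intro mult_left_mono) auto
    then show ?thesis using err(2)[of s] by fastforce
  qed
  have "10 * real M * E = 10 * (real M * \<Delta>t) * (real M * (1/6)^r)" by (simp add: E_def)
  also have "\<dots> \<le> 10 * (1/6) * (real M * (1/6)^r)"
    unfolding Mt using \<kappa> by (intro mult_right_mono mult_left_mono) auto
  also have "\<dots> = 10 * (real M * (1/6)^s)" by (simp add: r)
  finally have E: "10 * real M * E \<le> 10 * (real M * (1/6)^s)" .
  have "L2norm \<Omega> n M (\<lambda>i. w' i - W s i) \<le> 3 * B"
    by (rule L2norm_le_sup) (use wB BE M n in auto)
  moreover have "L2norm_grad \<Omega> n M (\<lambda>i j. grad \<Omega> n M d' i j - grad \<Omega> n M (D s) i j)
      \<le> 10 * real M * E"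
    by (rule L2norm_grad_le_sup) (use dE BE M n in auto)
  moreover have "3 * B + 10 * (real M * (1/6)^s) \<le> 32 * real M * (1/6)^s"
    by (simp add: B_def)
  ultimately show "L2norm \<Omega> n M (\<lambda>i. w' i - W s i)
          + L2norm_grad \<Omega> n M (\<lambda>i j. grad \<Omega> n M d' i j - grad \<Omega> n M (D s) i j)
         \<le> 32 * real M * (1/6)^s"
    using E by linarith
  have "\<forall>i\<in>grid \<Omega> n M. norm (W (s + 1) i - W s i) \<le> 2 * B"
  proof
    fix i assume "i \<in> grid \<Omega> n M"
    then show "norm (W (s + 1) i - W s i) \<le> 2 * B"
      using norm_triangle_ineq4[of "w' i - W s i" "w' i - W (s + 1) i"] wB wB' by fastforce
  qed
  then have "L2norm \<Omega> n M (\<lambda>i. W (s + 1) i - W s i) \<le> 3 * (2 * B)"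
    by (rule L2norm_le_sup) (use BE M n in auto)
  moreover have "\<forall>i\<in>grid \<Omega> n M. norm (D (s + 1) i - D s i) \<le> 2 * E"
  proof
    fix i assume "i \<in> grid \<Omega> n M"
    then show "norm (D (s + 1) i - D s i) \<le> 2 * E"
      using norm_triangle_ineq4[of "d' i - D s i" "d' i - D (s + 1) i"] dE dE' by fastforce
  qed
  then have "L2norm_grad \<Omega> n M (\<lambda>i j. grad \<Omega> n M (D (s + 1)) i j - grad \<Omega> n M (D s) i j)
      \<le> 10 * real M * (2 * E)"
    by (rule L2norm_grad_le_sup) (use BE M n in auto)
  moreover have "3 * (2 * B) + 2 * (10 * (real M * (1/6)^s)) = 32 * real M * (1/6)^s"
    by (simp add: B_def)
  ultimately show "L2norm \<Omega> n M (\<lambda>i. W (s + 1) i - W s i)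
          + L2norm_grad \<Omega> n M (\<lambda>i j. grad \<Omega> n M (D (s + 1)) i j - grad \<Omega> n M (D s) i j)
         \<le> 32 * real M * (1/6)^s"
    using E by linarith
qed

section \<open>Composing straight-line programs\<close>

lemma run_append:
  "run \<rho> (P @ Q) R = (case run \<rho> P R of None \<Rightarrow> None | Some R' \<Rightarrow> run \<rho> Q R')"
  by (induction \<rho> P R rule: run.induct) (auto split: option.splits)

lemma run_extends:
  "run \<rho> P R = Some R' \<Longrightarrow> \<exists>R''. R' = R @ R'' \<and> length R'' = length P"
  by (induction \<rho> P R arbitrary: R' rule: run.induct) (fastforce split: option.splits)+

lemma operand_val_append:
  "operand_val \<rho> R a = Some y \<Longrightarrow> operand_val \<rho> (R @ R') a = Some y"
  by (cases a) (auto simp: nth_append split: if_splits)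

text \<open>
  The inputs depend on a parameter \<open>x \<in> X\<close>, and programs must work for all of \<open>X\<close> at once. Quantities
  are therefore functions on \<open>X\<close>; \<open>X\<close> may carry more than the inputs see, for instance the iterates
  that the inputs determine only implicitly.
\<close>

locale straight_line =
  fixes X :: "'x set" and \<rho> :: "'x \<Rightarrow> input \<Rightarrow> real"
begin

definition succeeds :: "program \<Rightarrow> bool" where
  "succeeds P \<longleftrightarrow> (\<forall>x\<in>X. run (\<rho> x) P [] \<noteq> None)"

definition yields :: "program \<Rightarrow> ('x \<Rightarrow> real) \<Rightarrow> bool" where
  "yields P f \<longleftrightarrow>
     (\<exists>a. \<forall>x\<in>X. \<exists>R. run (\<rho> x) P [] = Some R \<and> operand_val (\<rho> x) R a = Some (f x))"

text \<open>
  Every program that provides \<open>S\<close> can be prolonged by at most \<open>c\<close> instructions to provide \<open>T\<close>.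
  Quantifying over the program that precedes hides the register numbers, and values in \<open>S\<close> can be
  shared at no cost.
\<close>

definition reach :: "('x \<Rightarrow> real) set \<Rightarrow> nat \<Rightarrow> ('x \<Rightarrow> real) set \<Rightarrow> bool" where
  "reach S c T \<longleftrightarrow> (\<forall>P. succeeds P \<and> (\<forall>f\<in>S. yields P f) \<longrightarrow>
     (\<exists>Q. length Q \<le> c \<and> succeeds (P @ Q) \<and> (\<forall>f\<in>T. yields (P @ Q) f)))"

lemma yields_append:
  assumes "yields P f" "succeeds (P @ Q)"
  shows "yields (P @ Q) f"
proof -
  obtain a where a: "\<And>x. x \<in> X \<Longrightarrow>
      \<exists>R. run (\<rho> x) P [] = Some R \<and> operand_val (\<rho> x) R a = Some (f x)"
    using assms(1) unfolding yields_def by blast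
  have "\<exists>R. run (\<rho> x) (P @ Q) [] = Some R \<and> operand_val (\<rho> x) R a = Some (f x)" if "x \<in> X" for x
  proof -
    obtain R where R: "run (\<rho> x) P [] = Some R" "operand_val (\<rho> x) R a = Some (f x)"
      using a \<open>x \<in> X\<close> by blast
    then obtain R' where R': "run (\<rho> x) Q R = Some R'"
      using assms(2) \<open>x \<in> X\<close> by (fastforce simp: succeeds_def run_append)
    then obtain R'' where "R' = R @ R''" using run_extends by blast
    then show ?thesis using R R' by (simp add: run_append operand_val_append)
  qed
  then show ?thesis unfolding yields_def by blast
qed

lemma reachE:
  assumes "reach S c T" "succeeds P" "\<And>f. f \<in> S \<Longrightarrow> yields P f"
  obtains Q where "length Q \<le> c" "succeeds (P @ Q)" "\<And>f. f \<in> S \<union> T \<Longrightarrow> yields (P @ Q) f"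
  using assms yields_append unfolding reach_def by (metis UnE)

lemma reach_mono:
  assumes "reach S c T" "S \<subseteq> S'" "c \<le> c'" "T' \<subseteq> T"
  shows "reach S' c' T'"
  unfolding reach_def
proof (intro allI impI)
  fix P assume "succeeds P \<and> (\<forall>f\<in>S'. yields P f)"
  then obtain Q where "length Q \<le> c" "succeeds (P @ Q)" "\<And>f. f \<in> S \<union> T \<Longrightarrow> yields (P @ Q) f"
    using assms(2) by (blast intro: reachE[OF assms(1)])
  then show "\<exists>Q. length Q \<le> c' \<and> succeeds (P @ Q) \<and> (\<forall>f\<in>T'. yields (P @ Q) f)"
    using assms(3,4) by (intro exI[of _ Q]) auto
qed

lemma reach_le: "reach S c T \<Longrightarrow> c \<le> c' \<Longrightarrow> reach S c' T"
  by (erule reach_mono) auto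

lemma reach_trans:
  assumes "reach S c T" "reach (S \<union> T) c' U"
  shows "reach S (c + c') (T \<union> U)"
  unfolding reach_def
proof (intro allI impI)
  fix P assume "succeeds P \<and> (\<forall>f\<in>S. yields P f)"
  then obtain Q where Q: "length Q \<le> c" "succeeds (P @ Q)"
      "\<And>f. f \<in> S \<union> T \<Longrightarrow> yields (P @ Q) f"
    by (blast intro: reachE[OF assms(1)])
  obtain Q' where "length Q' \<le> c'" "succeeds ((P @ Q) @ Q')"
      "\<And>f. f \<in> (S \<union> T) \<union> U \<Longrightarrow> yields ((P @ Q) @ Q') f"
    using reachE[OF assms(2) Q(2,3)] by blast
  then show "\<exists>Q. length Q \<le> c + c' \<and> succeeds (P @ Q) \<and> (\<forall>f\<in>T \<union> U. yields (P @ Q) f)"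
    using Q(1) by (intro exI[of _ "Q @ Q'"]) auto
qed

lemma reach_Un:
  assumes "reach S c T" "reach S c' U"
  shows "reach S (c + c') (T \<union> U)"
  by (rule reach_trans[OF assms(1)]) (rule reach_mono[OF assms(2)], auto)

lemma reach_member: "T \<subseteq> S \<Longrightarrow> reach S 0 T"
  unfolding reach_def by (auto intro!: exI[of _ "[]"])

lemma reach_UN:
  assumes "finite I" "\<And>i. i \<in> I \<Longrightarrow> reach S c (T i)"
  shows "reach S (card I * c) (\<Union>i\<in>I. T i)"
  using assms
proof (induction I rule: finite_induct)
  case empty
  then show ?case by (simp add: reach_member)
next
  case (insert i I)
  then show ?case using reach_Un[of S c "T i" "card I * c"] by simp
qed

lemma reach_input: "reach S 0 {\<lambda>x. \<rho> x v}"
  unfolding reach_def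
proof (intro allI impI)
  fix P assume P: "succeeds P \<and> (\<forall>f\<in>S. yields P f)"
  have "yields P (\<lambda>x. \<rho> x v)"
    using P unfolding yields_def succeeds_def by (intro exI[of _ "Inp v"]) auto
  then show "\<exists>Q. length Q \<le> 0 \<and> succeeds (P @ Q) \<and> (\<forall>f\<in>{\<lambda>x. \<rho> x v}. yields (P @ Q) f)"
    using P by simp
qed

lemma reach_cong:
  assumes "reach S c {f}" "\<And>x. x \<in> X \<Longrightarrow> f x = g x"
  shows "reach S c {g}"
proof -
  have "yields P f = yields P g" for P unfolding yields_def using assms(2) by simp
  then show ?thesis using assms(1) unfolding reach_def by simp
qed

lemma reach_op:
  assumes "reach S c {f}" "reach S c' {g}"
    and h: "\<And>x. x \<in> X \<Longrightarrow> apply_op p (f x) (g x) = Some (h x)"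
  shows "reach S (c + c' + 1) {h}"
proof -
  have "reach {f, g} 1 {h}"
    unfolding reach_def
  proof (intro allI impI)
    fix P assume P: "succeeds P \<and> (\<forall>k\<in>{f, g}. yields P k)"
    then obtain a b where ab:
        "\<And>x. x \<in> X \<Longrightarrow> \<exists>R. run (\<rho> x) P [] = Some R \<and> operand_val (\<rho> x) R a = Some (f x)"
        "\<And>x. x \<in> X \<Longrightarrow> \<exists>R. run (\<rho> x) P [] = Some R \<and> operand_val (\<rho> x) R b = Some (g x)"
      unfolding yields_def by blast
    have *: "\<exists>R. run (\<rho> x) (P @ [(p, a, b)]) [] = Some R \<and> operand_val (\<rho> x) R (Reg (length P)) = Some (h x)"
      if x: "x \<in> X" for x
    proof -
      obtain R where R: "run (\<rho> x) P [] = Some R" "operand_val (\<rho> x) R a = Some (f x)"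
          "operand_val (\<rho> x) R b = Some (g x)"
        using ab[OF x] by auto
      have "length P = length R" using run_extends[OF R(1)] by auto
      then show ?thesis using R h[OF x] by (simp add: run_append)
    qed
    have "succeeds (P @ [(p, a, b)])" unfolding succeeds_def
    proof
      fix x assume "x \<in> X"
      from *[OF this] show "run (\<rho> x) (P @ [(p, a, b)]) [] \<noteq> None" by (elim exE conjE) simp
    qed
    moreover have "yields (P @ [(p, a, b)]) h" unfolding yields_def using * by blast
    ultimately show "\<exists>Q. length Q \<le> 1 \<and> succeeds (P @ Q) \<and> (\<forall>k\<in>{h}. yields (P @ Q) k)"
      by (intro exI[of _ "[(p, a, b)]"]) simp
  qed
  then have "reach (S \<union> ({f} \<union> {g})) 1 {h}" by (rule reach_mono) auto
  then show ?thesis by (rule reach_mono[OF reach_trans[OF reach_Un[OF assms(1,2)]]]) auto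
qed

lemma reach_add:
  "reach S c {f} \<Longrightarrow> reach S c' {g} \<Longrightarrow> reach S (c + c' + 1) {\<lambda>x. f x + g x}"
  by (rule reach_op[where p = Add]) auto

lemma reach_diff:
  "reach S c {f} \<Longrightarrow> reach S c' {g} \<Longrightarrow> reach S (c + c' + 1) {\<lambda>x. f x - g x}"
  by (rule reach_op[where p = Sub]) auto

lemma reach_mult:
  "reach S c {f} \<Longrightarrow> reach S c' {g} \<Longrightarrow> reach S (c + c' + 1) {\<lambda>x. f x * g x}"
  by (rule reach_op[where p = Mul]) auto

lemma reach_divide:
  "reach S c {f} \<Longrightarrow> reach S c' {g} \<Longrightarrow> (\<And>x. x \<in> X \<Longrightarrow> g x \<noteq> 0) \<Longrightarrow>
    reach S (c + c' + 1) {\<lambda>x. f x / g x}"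
  by (rule reach_op[where p = Div]) auto

definition vreach :: "('x \<Rightarrow> real) set \<Rightarrow> nat \<Rightarrow> ('x \<Rightarrow> real^3) \<Rightarrow> bool" where
  "vreach S c f \<longleftrightarrow> (\<forall>k. reach S c {\<lambda>x. f x $ k})"

lemma vreach_le: "vreach S c f \<Longrightarrow> c \<le> c' \<Longrightarrow> vreach S c' f"
  unfolding vreach_def using reach_le by blast

lemma vreach_cong:
  "vreach S c f \<Longrightarrow> (\<And>x. x \<in> X \<Longrightarrow> f x = g x) \<Longrightarrow> vreach S c g"
  unfolding vreach_def by (metis (no_types, lifting) reach_cong)

lemma vreach_all:
  assumes "vreach S c f"
  shows "reach S (3 * c) (range (\<lambda>k x. f x $ k))"
proof -
  have "range (\<lambda>k x. f x $ k) = (\<Union>k\<in>UNIV. {\<lambda>x. f x $ k})" by blast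
  then show ?thesis
    using reach_UN[of "UNIV :: 3 set" S c "\<lambda>k. {\<lambda>x. f x $ k}"] assms by (simp add: vreach_def)
qed

lemma vreach_add: "vreach S c f \<Longrightarrow> vreach S c' g \<Longrightarrow> vreach S (c + c' + 1) (\<lambda>x. f x + g x)"
  unfolding vreach_def vector_add_component by (intro allI reach_add) blast+

lemma vreach_diff: "vreach S c f \<Longrightarrow> vreach S c' g \<Longrightarrow> vreach S (c + c' + 1) (\<lambda>x. f x - g x)"
  unfolding vreach_def vector_minus_component by (intro allI reach_diff) blast+

lemma vreach_scale:
  "reach S c {f} \<Longrightarrow> vreach S c' g \<Longrightarrow> vreach S (c + c' + 1) (\<lambda>x. f x *\<^sub>R g x)"
  unfolding vreach_def vector_scaleR_component real_scaleR_def by (intro allI reach_mult) blast+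

lemma reach_inner:
  assumes "vreach S c f" "vreach S c' g"
  shows "reach S (3 * (c + c') + 5) {\<lambda>x. f x \<bullet> g x}"
proof -
  have "reach S (c + c' + 1) {\<lambda>x. f x $ k * g x $ k}" for k
    using assms unfolding vreach_def by (intro reach_mult) auto
  note products = this
  have "(\<lambda>x. f x \<bullet> g x) = (\<lambda>x. f x $ 1 * g x $ 1 + f x $ 2 * g x $ 2 + f x $ 3 * g x $ 3)"
    by (simp add: inner_vec_def sum_3)
  then show ?thesis
    using reach_le[OF reach_add[OF reach_add[OF products[of 1] products[of 2]] products[of 3]]]
    by simp
qed

lemma vreach_cross:
  assumes "vreach S c f" "vreach S c' g"
  shows "vreach S (2 * (c + c') + 3) (\<lambda>x. f x \<times> g x)"
proof -
  have "reach S (c + c' + 1) {\<lambda>x. f x $ k * g x $ l}" for k l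
    using assms unfolding vreach_def by (intro reach_mult) auto
  from reach_diff[OF this this]
  have "reach S (2 * (c + c') + 3) {\<lambda>x. f x $ k * g x $ l - f x $ k' * g x $ l'}" for k l k' l'
    by (simp add: mult_2 add_ac numeral_3_eq_3)
  then show ?thesis unfolding vreach_def forall_3 by (simp add: cross3_def)
qed

lemma vreach_sum:
  assumes "\<And>j. j < n \<Longrightarrow> vreach S c (f j)"
  shows "vreach S (n * (c + 1) + 1) (\<lambda>x. \<Sum>j<n. f j x)"
  using assms
proof (induction n)
  case 0
  \<comment> \<open>Zero has to be computed, as the difference of the constant one with itself.\<close>
  have "reach S 1 {\<lambda>x. 0}"
    using reach_diff[OF reach_input[of S ConstOne] reach_input[of S ConstOne]] by simp
  then show ?case by (simp add: vreach_def)
next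
  case (Suc n)
  then have "vreach S (n * (c + 1) + 1) (\<lambda>x. \<Sum>j<n. f j x)" "vreach S c (f n)" by auto
  from vreach_add[OF this] show ?case
    unfolding sum.lessThan_Suc by (rule vreach_le) simp
qed

end

section \<open>Computing the iterates\<close>

text \<open>
  Data and iterates of one run of the iteration together form one value of the parameter; the
  iterates are then quantities to be reached from the data.
\<close>

type_synonym fp_run = "gridfun \<times> gridfun \<times> (nat \<Rightarrow> gridfun) \<times> (nat \<Rightarrow> gridfun)"

locale fp_programs =
  fixes \<Omega> :: grid_domain and n M :: nat and \<Delta>t :: real
  assumes M: "M > 0" and \<Delta>t: "\<Delta>t > 0"
begin

definition data :: "fp_run set" where
  "data = {(d, w, D, W). fp_iterates \<Omega> n M \<Delta>t d w D W}"

definition env :: "fp_run \<Rightarrow> input \<Rightarrow> real" where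
  "env x = input_val M \<Delta>t (fst x) (fst (snd x))"

abbreviation "d0 \<equiv> fst"
abbreviation "w0 \<equiv> \<lambda>x. fst (snd x)"
abbreviation "itD \<equiv> \<lambda>x. fst (snd (snd x))"
abbreviation "itW \<equiv> \<lambda>x. snd (snd (snd x))"

sublocale straight_line data env .

definition values_D :: "nat \<Rightarrow> (fp_run \<Rightarrow> real) set" where
  "values_D s = (\<Union>i\<in>grid \<Omega> n M. range (\<lambda>k x. itD x s i $ k))"

definition values_W :: "nat \<Rightarrow> (fp_run \<Rightarrow> real) set" where
  "values_W s = (\<Union>i\<in>grid \<Omega> n M. range (\<lambda>k x. itW x s i $ k))"

lemma reach_one: "reach S 0 {\<lambda>x. 1}"
  using reach_input[of S ConstOne] by (simp add: env_def)

lemma reach_half: "reach S 2 {\<lambda>x. 1/2}"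
proof -
  have "reach S 2 {\<lambda>x. 1 / (1 + 1)}"
    by (rule reach_le[OF reach_divide[OF reach_one reach_add[OF reach_one reach_one]]]) auto
  then show ?thesis by simp
qed

lemma reach_dt: "reach S 0 {\<lambda>x. \<Delta>t}"
  using reach_input[of S TimeStep] by (simp add: env_def)

lemma reach_mesh: "reach S 0 {\<lambda>x. mesh M}"
  using reach_input[of S MeshSize] by (simp add: env_def)

lemma vreach_d: "vreach S 0 (\<lambda>x. d0 x i)"
  unfolding vreach_def using reach_input[of S "DVal i k" for k] by (simp add: env_def)

lemma vreach_w: "vreach S 0 (\<lambda>x. w0 x i)"
  unfolding vreach_def using reach_input[of S "WVal i k" for k] by (simp add: env_def)

lemma vreach_D: "i \<in> grid \<Omega> n M \<Longrightarrow> values_D s \<subseteq> S \<Longrightarrow> vreach S 0 (\<lambda>x. itD x s i)"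
  unfolding vreach_def values_D_def by (intro allI reach_member) auto

lemma vreach_W: "i \<in> grid \<Omega> n M \<Longrightarrow> values_W s \<subseteq> S \<Longrightarrow> vreach S 0 (\<lambda>x. itW x s i)"
  unfolding vreach_def values_W_def by (intro allI reach_member) auto

lemma vreach_half_sum:
  assumes "vreach S c f" "vreach S c' g"
  shows "vreach S (c + c' + 4) (\<lambda>x. (1/2) *\<^sub>R (f x + g x))"
  by (rule vreach_le[OF vreach_scale[OF reach_half vreach_add[OF assms]]]) simp

lemma vreach_lap:
  assumes i: "i \<in> grid \<Omega> n M"
    and f: "\<And>i. i \<in> grid \<Omega> n M \<Longrightarrow> vreach S 0 (\<lambda>x. f x i)"
  shows "vreach S (7 * n + 1) (\<lambda>x. lap \<Omega> n M (f x) i)"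
proof -
  let ?e = "\<lambda>j c x. ext \<Omega> n M (f x) (i(j := i j + c))"
  have e: "vreach S 0 (?e j c)" if jc: "j < n" "c \<in> {-1, 0, 1}" for j c
  proof -
    obtain i' where "i' \<in> grid \<Omega> n M" "\<And>f. ext \<Omega> n M f (i(j := i j + c)) = f i'"
      using ext_neighbour[OF i jc M] by blast
    then show ?thesis using f by simp
  qed
  have h: "reach S 2 {\<lambda>x. 1 / (mesh M * mesh M)}"
    by (rule reach_le[OF reach_divide[OF reach_one reach_mult[OF reach_mesh reach_mesh]]])
      (use M in \<open>auto simp: mesh_def\<close>)
  have "vreach S 6 (\<lambda>x. (1 / (mesh M * mesh M)) *\<^sub>R ((?e j 1 x - ?e j 0 x) - (?e j 0 x - ?e j (-1) x)))"
    if "j < n" for j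
    by (rule vreach_le[OF vreach_scale[OF h vreach_diff[OF vreach_diff[OF e e] vreach_diff[OF e e]]]])
      (use that in auto)
  from vreach_sum[OF this] show ?thesis
    unfolding lap_eq by (rule vreach_le) auto
qed

text \<open>
  In \<open>x = r + x \<times> c\<close> the vector \<open>c\<close> is \<open>\<Delta>t / 2\<close> times the averaged velocity and
  \<open>r = d + d \<times> c\<close>. The count \<open>235\<close> is the size of the solution formula for one component, with all
  subexpressions evaluated anew at each occurrence.
\<close>

lemma step_D:
  assumes i: "i \<in> grid \<Omega> n M" and S: "values_W s \<subseteq> S"
  shows "vreach S 235 (\<lambda>x. itD x (Suc s) i)"
proof -
  let ?c = "\<lambda>x. (\<Delta>t * (1/2)) *\<^sub>R ((1/2) *\<^sub>R (w0 x i + itW x s i))"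
  let ?r = "\<lambda>x. d0 x i + d0 x i \<times> ?c x"
  have c: "vreach S 8 ?c"
    by (rule vreach_le[OF vreach_scale[OF reach_mult[OF reach_dt reach_half]
        vreach_half_sum[OF vreach_w vreach_W[OF i S]]]]) simp
  have r: "vreach S 20 ?r"
    by (rule vreach_le[OF vreach_add[OF vreach_d vreach_cross[OF vreach_d c]]]) simp
  have denom: "reach S 55 {\<lambda>x. 1 / (1 + ?c x \<bullet> ?c x)}"
  proof -
    have "1 + ?c x \<bullet> ?c x \<noteq> 0" for x using inner_ge_zero[of "?c x"] by linarith
    then show ?thesis
      by (intro reach_le[OF reach_divide[OF reach_one reach_add[OF reach_one reach_inner[OF c c]]]])
        simp_all
  qed
  have num: "vreach S 179 (\<lambda>x. ?r x + ?r x \<times> ?c x + (?r x \<bullet> ?c x) *\<^sub>R ?c x)"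
    by (rule vreach_le[OF vreach_add[OF vreach_add[OF r vreach_cross[OF r c]]
          vreach_scale[OF reach_inner[OF r c] c]]]) simp
  have sol: "(1 / (1 + ?c x \<bullet> ?c x)) *\<^sub>R (?r x + ?r x \<times> ?c x + (?r x \<bullet> ?c x) *\<^sub>R ?c x) = itD x (Suc s) i"
    if "x \<in> data" for x
  proof -
    have "fp_iterates \<Omega> n M \<Delta>t (d0 x) (w0 x) (itD x) (itW x)"
      using that by (auto simp: data_def)
    from fp_step_iterates[OF \<Delta>t this] i
    have "itD x (Suc s) i = d0 x i + \<Delta>t *\<^sub>R (((1/2) *\<^sub>R (d0 x i + itD x (Suc s) i))
            \<times> ((1/2) *\<^sub>R (w0 x i + itW x s i)))"
      unfolding fp_step_def by blast
    then have "itD x (Suc s) i = ?r x + itD x (Suc s) i \<times> ?c x"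
      by (rule midpoint_equation)
    then show ?thesis by (rule cross_equation_solution[symmetric])
  qed
  show ?thesis
    by (rule vreach_le[OF vreach_cong[OF vreach_scale[OF denom num] sol]]) simp_all
qed

lemma step_W:
  assumes i: "i \<in> grid \<Omega> n M" and S: "values_D (Suc s) \<subseteq> S"
  shows "vreach S (28 * n + 25) (\<lambda>x. itW x (Suc s) i)"
proof -
  have "vreach S (7 * n + 1) (\<lambda>x. lap \<Omega> n M (d0 x) i)"
    using i vreach_d by (rule vreach_lap)
  moreover have "vreach S (7 * n + 1) (\<lambda>x. lap \<Omega> n M (itD x (Suc s)) i)"
    using i vreach_D[OF _ S] by (rule vreach_lap)
  ultimately have "vreach S (14 * n + 6)
      (\<lambda>x. (1/2) *\<^sub>R (lap \<Omega> n M (d0 x) i + lap \<Omega> n M (itD x (Suc s)) i))"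
    by (intro vreach_le[OF vreach_half_sum]) auto
  then have "vreach S (28 * n + 25) (\<lambda>x. w0 x i + \<Delta>t *\<^sub>R
      (((1/2) *\<^sub>R (lap \<Omega> n M (d0 x) i + lap \<Omega> n M (itD x (Suc s)) i))
        \<times> ((1/2) *\<^sub>R (d0 x i + itD x (Suc s) i))))"
    by (intro vreach_le[OF vreach_add[OF vreach_w vreach_scale[OF reach_dt vreach_cross[OF _
          vreach_half_sum[OF vreach_d vreach_D[OF i S]]]]]]) auto
  then show ?thesis
  proof (rule vreach_cong)
    fix x assume "x \<in> data"
    then have "fp_iterates \<Omega> n M \<Delta>t (d0 x) (w0 x) (itD x) (itW x)" by (auto simp: data_def)
    from fp_step_iterates[OF \<Delta>t this] i
    show "w0 x i + \<Delta>t *\<^sub>R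
      (((1/2) *\<^sub>R (lap \<Omega> n M (d0 x) i + lap \<Omega> n M (itD x (Suc s)) i))
        \<times> ((1/2) *\<^sub>R (d0 x i + itD x (Suc s) i))) = itW x (Suc s) i"
      unfolding fp_step_def by simp
  qed
qed

lemma reach_iterate:
  "reach {} (s * (card (grid \<Omega> n M) * (84 * n + 780))) (values_D s \<union> values_W s)"
proof (induction s)
  case 0
  have "vreach {} 0 (\<lambda>x. itD x 0 i)" if "i \<in> grid \<Omega> n M" for i
    by (rule vreach_cong[OF vreach_d[of _ i]]) (use that in \<open>auto simp: data_def fp_iterates_def\<close>)
  moreover have "vreach {} 0 (\<lambda>x. itW x 0 i)" if "i \<in> grid \<Omega> n M" for i
    by (rule vreach_cong[OF vreach_w[of _ i]]) (use that in \<open>auto simp: data_def fp_iterates_def\<close>)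
  ultimately have "reach {} (card (grid \<Omega> n M) * (3 * 0)) (values_D 0)"
      "reach {} (card (grid \<Omega> n M) * (3 * 0)) (values_W 0)"
    unfolding values_D_def values_W_def by (intro reach_UN[OF finite_grid] vreach_all; simp)+
  from reach_Un[OF this] show ?case by simp
next
  case (Suc s)
  let ?G = "card (grid \<Omega> n M)"
  have D: "reach S (?G * (3 * 235)) (values_D (Suc s))" if "values_W s \<subseteq> S" for S
    unfolding values_D_def by (intro reach_UN[OF finite_grid] vreach_all step_D that)
  have W: "reach S (?G * (3 * (28 * n + 25))) (values_W (Suc s))" if "values_D (Suc s) \<subseteq> S" for S
    unfolding values_W_def by (intro reach_UN[OF finite_grid] vreach_all step_W that)
  have "reach ({} \<union> (values_D s \<union> values_W s)) (?G * (3 * 235) + ?G * (3 * (28 * n + 25)))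
      (values_D (Suc s) \<union> values_W (Suc s))"
    by (rule reach_trans[OF D W]) auto
  from reach_trans[OF Suc.IH this] show ?case
    by (rule reach_mono) (auto simp: algebra_simps)
qed

lemma iterate_computable:
  "iterate_computable \<Omega> n M \<Delta>t s (real (s * (card (grid \<Omega> n M) * (84 * n + 780))))"
proof -
  have "succeeds []" by (simp add: succeeds_def)
  from reachE[OF reach_iterate this] obtain P where
    P: "length P \<le> s * (card (grid \<Omega> n M) * (84 * n + 780))" "succeeds P"
      "\<And>f. f \<in> values_D s \<union> values_W s \<Longrightarrow> yields P f"
    by auto
  have "\<forall>i k. i \<in> grid \<Omega> n M \<longrightarrow> (\<exists>a. \<forall>x\<in>data. \<exists>R. run (env x) P [] = Some R \<and>
      operand_val (env x) R a = Some (itD x s i $ k))"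
  proof (intro allI impI)
    fix i k assume "i \<in> grid \<Omega> n M"
    then have "(\<lambda>x. itD x s i $ k) \<in> values_D s \<union> values_W s" by (auto simp: values_D_def)
    from P(3)[OF this] show "\<exists>a. \<forall>x\<in>data. \<exists>R. run (env x) P [] = Some R \<and>
      operand_val (env x) R a = Some (itD x s i $ k)" unfolding yields_def .
  qed
  then obtain od where od: "\<And>i k x. i \<in> grid \<Omega> n M \<Longrightarrow> x \<in> data \<Longrightarrow>
      \<exists>R. run (env x) P [] = Some R \<and> operand_val (env x) R (od i k) = Some (itD x s i $ k)"
    by metis
  have "\<forall>i k. i \<in> grid \<Omega> n M \<longrightarrow> (\<exists>a. \<forall>x\<in>data. \<exists>R. run (env x) P [] = Some R \<and>
      operand_val (env x) R a = Some (itW x s i $ k))"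
  proof (intro allI impI)
    fix i k assume "i \<in> grid \<Omega> n M"
    then have "(\<lambda>x. itW x s i $ k) \<in> values_D s \<union> values_W s" by (auto simp: values_W_def)
    from P(3)[OF this] show "\<exists>a. \<forall>x\<in>data. \<exists>R. run (env x) P [] = Some R \<and>
      operand_val (env x) R a = Some (itW x s i $ k)" unfolding yields_def .
  qed
  then obtain ow where ow: "\<And>i k x. i \<in> grid \<Omega> n M \<Longrightarrow> x \<in> data \<Longrightarrow>
      \<exists>R. run (env x) P [] = Some R \<and> operand_val (env x) R (ow i k) = Some (itW x s i $ k)"
    by metis
  show ?thesis
    unfolding iterate_computable_def
  proof (rule exI[of _ P], rule exI[of _ od], rule exI[of _ ow], intro conjI allI impI)
    show "real (length P) \<le> real (s * (card (grid \<Omega> n M) * (84 * n + 780)))"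
      using P(1) by (rule of_nat_mono)
    fix d w D W assume "fp_iterates \<Omega> n M \<Delta>t d w D W"
    then have x: "(d, w, D, W) \<in> data" by (simp add: data_def)
    then obtain R where R: "run (input_val M \<Delta>t d w) P [] = Some R"
      using P(2) by (fastforce simp: succeeds_def env_def)
    show "\<exists>R. run (input_val M \<Delta>t d w) P [] = Some R \<and>
        (\<forall>i\<in>grid \<Omega> n M. \<forall>k.
           operand_val (input_val M \<Delta>t d w) R (od i k) = Some (D s i $ k) \<and>
           operand_val (input_val M \<Delta>t d w) R (ow i k) = Some (W s i $ k))"
      using R od[OF _ x] ow[OF _ x] by (intro exI[of _ R]) (auto simp: env_def)
  qed
qed

end

section \<open>Logarithmically many iterations\<close>

lemma ln_ge_1:
  assumes "x \<ge> 3"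
  shows "ln x \<ge> (1::real)"
proof -
  have "exp 1 \<le> x" using exp_le assms by linarith
  then show ?thesis using assms by (subst ln_ge_iff) auto
qed

text \<open>
  Since \<open>1/6 < 1/e\<close>, the first \<open>(1 + \<alpha>) ln N\<close> iterations already gain the factor
  \<open>N\<close> to the power \<open>-(1 + \<alpha>)\<close>, and five more absorb the constant.
\<close>

lemma geometric_below_tolerance:
  assumes N: "N \<ge> 1" and MN: "M \<le> N" and s: "s \<ge> nat \<lceil>(1 + \<alpha>) * ln (real N)\<rceil> + 5"
  shows "32 * real M * (1/6)^s < real N powr (- \<alpha>)"
proof -
  define r where "r = s - 5"
  have sr: "s = r + 5" using s by (simp add: r_def)
  have r: "(1 + \<alpha>) * ln (real N) \<le> real r"
    using s real_nat_ceiling_ge[of "(1 + \<alpha>) * ln (real N)"] unfolding r_def by linarith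
  have "(1/6::real)^r \<le> (exp (-1))^r"
  proof (rule power_mono)
    have "exp 1 \<le> (6::real)" using exp_le by linarith
    then show "1/6 \<le> exp (-1::real)" by (simp add: exp_minus field_simps)
  qed simp
  also have "\<dots> = exp (- real r)" by (simp add: exp_of_nat_mult[symmetric])
  also have "\<dots> \<le> exp (- ((1 + \<alpha>) * ln (real N)))" using r by simp
  also have "\<dots> = real N powr (- (1 + \<alpha>))" using N by (simp add: powr_def algebra_simps)
  finally have q: "(1/6::real)^r \<le> real N powr (- (1 + \<alpha>))" .
  have "32 * real M * (1/6)^s = 32 * (1/6)^5 * (real M * (1/6)^r)"
    by (simp add: sr power_add)
  also have "\<dots> \<le> 32 * (1/6)^5 * (real N * real N powr (- (1 + \<alpha>)))"
    using q MN by (intro mult_left_mono mult_mono) auto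
  also have "real N * real N powr (- (1 + \<alpha>)) = real N powr (- \<alpha>)"
  proof -
    have "real N * real N powr (- (1 + \<alpha>)) = real N powr 1 * real N powr (- (1 + \<alpha>))"
      using N by simp
    also have "\<dots> = real N powr (- \<alpha>)" by (subst powr_add[symmetric]) simp
    finally show ?thesis .
  qed
  also have "32 * (1/6)^5 * real N powr (- \<alpha>) < 1 * real N powr (- \<alpha>)"
    using N by (intro mult_strict_right_mono) (auto simp: power_divide)
  finally show ?thesis by simp
qed

lemma iteration_count_le:
  assumes "N \<ge> 4" "\<alpha> > 0"
  shows "real (nat \<lceil>(1 + \<alpha>) * ln (real N)\<rceil> + 5) \<le> (7 + \<alpha>) * ln (real N)"
proof -
  have l: "ln (real N) \<ge> 1" using assms by (intro ln_ge_1) auto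
  then have "(1 + \<alpha>) * ln (real N) \<ge> 0" using assms by simp
  then have "real (nat \<lceil>(1 + \<alpha>) * ln (real N)\<rceil>) \<le> (1 + \<alpha>) * ln (real N) + 1"
    by linarith
  then show ?thesis using l by (simp add: algebra_simps)
qed

lemma iterate_computable_mono:
  assumes "iterate_computable \<Omega> n M \<Delta>t s c" "c \<le> c'"
  shows "iterate_computable \<Omega> n M \<Delta>t s c'"
  using assms(1) unfolding iterate_computable_def
  by (elim ex_forward conj_forward) (rule order_trans[OF _ assms(2)], assumption | assumption)+

theorem corollary4p4:
  shows "\<exists>\<kappa>\<^sub>0::real. \<kappa>\<^sub>0 > 0 \<and> (\<forall>n::nat. n \<in> {2, 3} \<longrightarrow>
    (\<forall>\<kappa> K \<alpha> :: real. 0 < \<kappa> \<and> \<kappa> \<le> \<kappa>\<^sub>0 \<and> K > 0 \<and> \<alpha> > 0 \<longrightarrow>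
      (\<exists>C::real. \<forall>(\<Omega>::grid_domain) (M::nat) (N::nat) (\<Delta>t::real) (\<epsilon>::real)
           (d :: nat \<Rightarrow> gridfun) (w :: nat \<Rightarrow> gridfun) (m::nat)
           (D :: nat \<Rightarrow> gridfun) (W :: nat \<Rightarrow> gridfun).
         M \<ge> 2 \<and> N = M ^ n \<and> \<Delta>t = \<kappa> * mesh M \<and> \<epsilon> = real N powr (- \<alpha>) \<and>
         scheme \<Omega> n M \<Delta>t d w \<and>
         (\<forall>i\<in>grid \<Omega> n M. norm (d 0 i) \<le> 1) \<and>
         energy \<Omega> n M (d 0) (w 0) \<le> K \<and>
         fp_iterates \<Omega> n M \<Delta>t (d m) (w m) D W \<longrightarrow>
         (\<exists>sbar::nat. sbar \<ge> 1 \<and>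
            L2norm \<Omega> n M (\<lambda>i. W (sbar + 1) i - W sbar i)
              + L2norm_grad \<Omega> n M
                  (\<lambda>i j. grad \<Omega> n M (D (sbar + 1)) i j - grad \<Omega> n M (D sbar) i j) < \<epsilon> \<and>
            (\<forall>s\<ge>sbar.
               L2norm \<Omega> n M (\<lambda>i. w (m + 1) i - W s i)
                 + L2norm_grad \<Omega> n M
                     (\<lambda>i j. grad \<Omega> n M (d (m + 1)) i j - grad \<Omega> n M (D s) i j) < \<epsilon>) \<and>
            iterate_computable \<Omega> n M \<Delta>t sbar (C * (real N * ln (real N)))))))"
proof -
  have "\<exists>sbar\<ge>1.
            L2norm \<Omega> n M (\<lambda>i. W (sbar + 1) i - W sbar i)
              + L2norm_grad \<Omega> n M
                  (\<lambda>i j. grad \<Omega> n M (D (sbar + 1)) i j - grad \<Omega> n M (D sbar) i j) < \<epsilon> \<and>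
            (\<forall>s\<ge>sbar.
               L2norm \<Omega> n M (\<lambda>i. w (m + 1) i - W s i)
                 + L2norm_grad \<Omega> n M
                     (\<lambda>i j. grad \<Omega> n M (d (m + 1)) i j - grad \<Omega> n M (D s) i j) < \<epsilon>) \<and>
            iterate_computable \<Omega> n M \<Delta>t sbar (8256 * (7 + \<alpha>) * (real N * ln (real N)))"
    if n: "n \<in> {2, 3}" and \<kappa>: "0 < \<kappa>" "\<kappa> \<le> 1/6" and \<alpha>: "\<alpha> > 0" and M: "M \<ge> 2"
      and N: "N = M ^ n" and t: "\<Delta>t = \<kappa> * mesh M" and \<epsilon>: "\<epsilon> = real N powr (- \<alpha>)"
      and scheme: "scheme \<Omega> n M \<Delta>t d w" and d0: "\<forall>i\<in>grid \<Omega> n M. norm (d 0 i) \<le> 1"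
      and F: "fp_iterates \<Omega> n M \<Delta>t (d m) (w m) D W"
    for n M N m :: nat and \<Omega> and \<kappa> \<alpha> \<Delta>t \<epsilon> :: real and d w D W :: "nat \<Rightarrow> gridfun"
  proof -
    define sbar where "sbar = nat \<lceil>(1 + \<alpha>) * ln (real N)\<rceil> + 5"
    have n3: "n \<le> 3" and M1: "M \<ge> 1" using n M by auto
    have t0: "\<Delta>t > 0" using t \<kappa> M by (simp add: mesh_def)
    have "M ^ 2 \<le> N" unfolding N using n M by (intro power_increasing) auto
    moreover have "2 * M \<le> M ^ 2" using M by (simp add: power2_eq_square)
    ultimately have N4: "N \<ge> 4" and MN: "M \<le> N" using M by linarith+
    have p: "fp_step \<Omega> n M \<Delta>t (d m) (w m) (w (m + 1)) (d (m + 1)) (w (m + 1))"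
      using fp_step_scheme[OF t0 scheme] by simp
    note conv = iterates_converge[OF \<kappa> n3 M1 t p F scheme_norm_le_1[OF t0 scheme d0]]
    have small: "32 * real M * (1/6)^s < \<epsilon>" if "s \<ge> sbar" for s
      unfolding \<epsilon> using N4 MN that by (intro geometric_below_tolerance) (auto simp: sbar_def)
    interpret fp_programs \<Omega> n M \<Delta>t using M t0 by unfold_locales auto
    \<comment> \<open>The cost \<open>84 n + 780\<close> of one iteration at one grid point is at most \<open>1032\<close> for \<open>n \<le> 3\<close>.\<close>
    have "real (sbar * (card (grid \<Omega> n M) * (84 * n + 780)))
        = real sbar * (real (card (grid \<Omega> n M)) * real (84 * n + 780))" by simp
    also have "\<dots> \<le> ((7 + \<alpha>) * ln (real N)) * ((8 * real N) * 1032)"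
    proof (intro mult_mono)
      show "real sbar \<le> (7 + \<alpha>) * ln (real N)"
        unfolding sbar_def by (rule iteration_count_le[OF N4 \<alpha>])
      show "real (card (grid \<Omega> n M)) \<le> 8 * real N"
        using card_grid_le[OF M1 n3] by (simp add: N)
    qed (use n3 N4 \<alpha> in auto)
    also have "\<dots> = 8256 * (7 + \<alpha>) * (real N * ln (real N))" by simp
    finally have "iterate_computable \<Omega> n M \<Delta>t sbar (8256 * (7 + \<alpha>) * (real N * ln (real N)))"
      by (rule iterate_computable_mono[OF iterate_computable])
    moreover have "sbar \<ge> 1" by (simp add: sbar_def)
    ultimately show ?thesis
      using conv small by (meson le_trans order_le_less_trans order_refl)
  qed
  note logarithmic = this
  show ?thesis
  proof (rule exI[of _ "1/6"], intro conjI allI impI, goal_cases)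
    case 1
    show ?case by simp
  next
    case (2 n \<kappa> K \<alpha>)
    show ?case
      by (rule exI[of _ "8256 * (7 + \<alpha>)"], intro allI impI, elim conjE, rule logarithmic)
        (use 2 in blast)+
  qed
qed

end
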